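(* Let $n\ge3$, $\mu\in\mathbb{R}^n$, $\sigma>0$, and let $x_1<\dots<x_n$ be real numbers. Let $y=\mu+\xi$ with $\xi\sim\mathcal{N}(0,\sigma^2I_{n\times n})$. Then for any $x>0$, the estimator $\hat\mu=\hat\mu^{LS}(\mathcal{K}^C_{x_1,\dots,x_n})$ satisfies $$\|\hat\mu-\mu\|^2\le\min_{u\in\mathcal{K}^C_{x_1,\dots,x_n}}\left(\|u-\mu\|^2+\frac{16\sigma^2q(u)}{n}\log\frac{en}{q(u)}\right)+\frac{4\sigma^2x}{n}$$ with probability greater than $1-\exp(-x)$.
   Context: Scaled norm: $\|v\|^2=\frac1n\sum_{i=1}^n v_i^2$ for $v\in\mathbb{R}^n$. $\mathcal{K}^C_{x_1,\dots,x_n}=\left\{u\in\mathbb{R}^n:\ \frac{u_i-u_{i-1}}{x_i-x_{i-1}}\le\frac{u_{i+1}-u_i}{x_{i+1}-x_i},\ i=2,\dots,n-1\right\}$. For $u\in\mathcal{K}^C_{x_1,\dots,x_n}$, $u$ is piecewise affine with $k$ pieces if there exist real numbers $a_1,\dots,a_k$ and a partition $(T_1,\dots,T_k)$ of $\{1,\dots,n\}$ such that $u_i=a_j(x_i-x_l)+u_l$ for all $i,l\in T_j$ and all $j=1,\dots,k$; $q(u)\ge1$ is the smallest integer such that $u$ is piecewise affine with $q(u)$ pieces. The least squares estimator over a nonempty closed set $K$ is $\hat\mu^{LS}(K)\in\operatorname{argmin}_{v\in K}\|y-v\|^2$. *)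

theory Defs
  imports "HOL-Probability.Probability"
begin

text \<open>
  A vector of \<open>\<real>\<^sup>n\<close> is a function of type \<^typ>\<open>nat \<Rightarrow> real\<close>, of which only the values at
  \<open>1, \<dots>, n\<close> matter. Members of \<open>convex_seqs\<close> are normalised to be \<open>undefined\<close> outside
  \<open>{1..n}\<close>, so that this set is in bijection with the cone in \<open>\<real>\<^sup>n\<close>, and the least squares
  estimator over it is unique.
\<close>

definition scaled_norm_sq :: "nat \<Rightarrow> (nat \<Rightarrow> real) \<Rightarrow> real" where
  "scaled_norm_sq n v = (1 / real n) * (\<Sum>i=1..n. (v i)\<^sup>2)"

definition convex_seqs :: "nat \<Rightarrow> (nat \<Rightarrow> real) \<Rightarrow> (nat \<Rightarrow> real) set" where
  "convex_seqs n x = {u \<in> {1..n} \<rightarrow>\<^sub>E UNIV.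
     \<forall>i\<in>{2..n - 1}. (u i - u (i - 1)) / (x i - x (i - 1)) \<le> (u (i + 1) - u i) / (x (i + 1) - x i)}"

definition piecewise_affine :: "nat \<Rightarrow> (nat \<Rightarrow> real) \<Rightarrow> (nat \<Rightarrow> real) \<Rightarrow> nat \<Rightarrow> bool" where
  "piecewise_affine n x u k \<longleftrightarrow>
     (\<exists>(a :: nat \<Rightarrow> real) (T :: nat \<Rightarrow> nat set).
        inj_on T {1..k} \<and> partition_on {1..n} (T ` {1..k}) \<and>
        (\<forall>j\<in>{1..k}. \<forall>i\<in>T j. \<forall>l\<in>T j. u i = a j * (x i - x l) + u l))"

definition num_pieces :: "nat \<Rightarrow> (nat \<Rightarrow> real) \<Rightarrow> (nat \<Rightarrow> real) \<Rightarrow> nat" where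
  "num_pieces n x u = (LEAST k. k \<ge> 1 \<and> piecewise_affine n x u k)"

definition least_squares :: "nat \<Rightarrow> (nat \<Rightarrow> real) set \<Rightarrow> (nat \<Rightarrow> real) \<Rightarrow> (nat \<Rightarrow> real)" where
  "least_squares n K y = arg_min (\<lambda>v. scaled_norm_sq n (\<lambda>i. y i - v i)) (\<lambda>v. v \<in> K)"

end

theory Submission
  imports Defs "HOL-Combinatorics.Multiset_Permutations" "HOL-Library.Sublist"
begin

text \<open>
  The variational inequality for the projection bounds the excess loss, multiplied by \<open>n\<close>, by
  \<open>\<Sum>i. 2 \<xi>\<^sub>i w\<^sub>i - w\<^sub>i\<^sup>2\<close> with \<open>w\<close> the difference of the estimator and \<open>u\<close>. On a piece \<open>T\<close> of \<open>u\<close>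
  the sequence \<open>w\<close> is convex (whether or not \<open>T\<close> is an interval), hence antitone and then monotone.
  So \<open>exp\<close> of this excess divided by \<open>4\<sigma>\<^sup>2\<close> is at most a product over the pieces of sums, over the
  position of the minimum, of exponentials of the gains of two monotone cones on disjoint sets of
  indices.

  For a monotone cone on \<open>k\<close> points, the gain is \<open>\<Sum>\<^sub>B (\<Sum>i\<in>B. \<xi>\<^sub>i)\<^sup>2 / |B|\<close> over the blocks \<open>B\<close> of
  the greatest convex minorant of the partial sums. Averaging over all orderings of the points and
  applying the cycle lemma to each block, as in Spitzer's identity, replaces the random blocks by a
  sum over all set partitions with weights \<open>\<Prod>\<^sub>B (|B| - 1)!\<close>. As \<open>E exp (N\<^sup>2/4) = \<surd>2 \<le> 2\<close> for
  standard normal \<open>N\<close>, the exponential moment is at most \<open>(k + 1)! / k! = k + 1\<close>. AM-GM over the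
  pieces and Markov's inequality finish the proof, with room to spare for the strict inequality and
  for a near-minimiser in place of the minimiser.
\<close>

section \<open>Gains over monotone sequences\<close>

definition gain :: "('i \<Rightarrow> real) \<Rightarrow> ('i \<Rightarrow> real) \<Rightarrow> 'i \<Rightarrow> real" where
  "gain g w i = 2 * g i * w i - (w i)\<^sup>2"

definition monotone_gain :: "('i \<Rightarrow> real) \<Rightarrow> 'i list \<Rightarrow> real" where
  "monotone_gain g xs = (SUP w\<in>{w. sorted (map w xs)}. \<Sum>i\<leftarrow>xs. gain g w i)"

lemma gain_le_square: "gain g w i \<le> (g i)\<^sup>2"
  using zero_le_power2[of "g i - w i"] by (simp add: gain_def power2_diff)

lemma bdd_above_sum_list_gain: "bdd_above ((\<lambda>w. \<Sum>i\<leftarrow>xs. gain g w i) ` W)"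
  by (rule bdd_aboveI2[where M = "\<Sum>i\<leftarrow>xs. (g i)\<^sup>2"]) (intro sum_list_mono gain_le_square)

lemma ex_sorted_map: "\<exists>w :: 'i \<Rightarrow> real. sorted (map w xs)"
  by (rule exI[of _ "\<lambda>_. 0"]) (simp add: map_replicate_const sorted_replicate)

lemma sum_list_gain_le_monotone_gain:
  assumes "sorted (map w xs)"
  shows "(\<Sum>i\<leftarrow>xs. gain g w i) \<le> monotone_gain g xs"
  unfolding monotone_gain_def using assms
  by (intro cSUP_upper bdd_above_sum_list_gain) auto

lemma monotone_gain_le:
  assumes "\<And>w. sorted (map w xs) \<Longrightarrow> (\<Sum>i\<leftarrow>xs. gain g w i) \<le> c"
  shows "monotone_gain g xs \<le> c"
  unfolding monotone_gain_def using assms ex_sorted_map[of xs]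
  by (intro cSUP_least) auto

lemma monotone_gain_Nil [simp]: "monotone_gain g [] = 0"
  by (intro antisym monotone_gain_le) (use sum_list_gain_le_monotone_gain[of g "[]" g] in simp_all)

lemma monotone_gain_append_le:
  "monotone_gain g (ys @ zs) \<le> monotone_gain g ys + monotone_gain g zs"
  by (rule monotone_gain_le)
    (auto simp: sorted_append intro!: add_mono sum_list_gain_le_monotone_gain)

lemma monotone_gain_cong:
  assumes "\<And>i. i \<in> set xs \<Longrightarrow> g i = h i"
  shows "monotone_gain g xs = monotone_gain h xs"
proof -
  have "(\<Sum>i\<leftarrow>xs. gain g w i) = (\<Sum>i\<leftarrow>xs. gain h w i)" for w
    using assms by (intro arg_cong[where f = sum_list] map_cong) (auto simp: gain_def)
  then show ?thesis by (simp add: monotone_gain_def)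
qed

lemma monotone_gain_map:
  assumes "inj_on p (set xs)"
  shows "monotone_gain g (map p xs) = monotone_gain (g \<circ> p) xs"
proof (rule antisym)
  show "monotone_gain g (map p xs) \<le> monotone_gain (g \<circ> p) xs"
  proof (rule monotone_gain_le)
    fix w :: "'b \<Rightarrow> real" assume "sorted (map w (map p xs))"
    then show "(\<Sum>j\<leftarrow>map p xs. gain g w j) \<le> monotone_gain (g \<circ> p) xs"
      using sum_list_gain_le_monotone_gain[of "w \<circ> p" xs "g \<circ> p"]
      by (simp add: gain_def comp_def)
  qed
  show "monotone_gain (g \<circ> p) xs \<le> monotone_gain g (map p xs)"
  proof (rule monotone_gain_le)
    fix w :: "'a \<Rightarrow> real" assume w: "sorted (map w xs)"
    define v where "v = w \<circ> inv_into (set xs) p"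
    have v: "v (p i) = w i" if "i \<in> set xs" for i
      using that assms by (simp add: v_def)
    have "(\<Sum>i\<leftarrow>xs. gain (g \<circ> p) w i) = (\<Sum>j\<leftarrow>map p xs. gain g v j)"
      using v by (simp add: gain_def comp_def cong: map_cong)
    also have "\<dots> \<le> monotone_gain g (map p xs)"
      using w v by (intro sum_list_gain_le_monotone_gain) (simp add: comp_def cong: map_cong)
    finally show "(\<Sum>i\<leftarrow>xs. gain (g \<circ> p) w i) \<le> monotone_gain g (map p xs)" .
  qed
qed

lemma monotone_gain_nth:
  assumes "distinct xs"
  shows "monotone_gain (\<lambda>k. g (xs ! k)) [0..<length xs] = monotone_gain g xs"
proof -
  have "monotone_gain g (map ((!) xs) [0..<length xs]) = monotone_gain (g \<circ> (!) xs) [0..<length xs]"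
    using assms by (intro monotone_gain_map inj_on_nth) auto
  then show ?thesis by (simp only: map_nth comp_def)
qed

section \<open>Block decomposition of an ordering\<close>

definition avg :: "('i \<Rightarrow> real) \<Rightarrow> 'i set \<Rightarrow> real" where
  "avg g P = sum g P / real (card P)"

definition block_gain :: "('i \<Rightarrow> real) \<Rightarrow> 'i set \<Rightarrow> real" where
  "block_gain g P = (sum g P)\<^sup>2 / real (card P)"

lemma avg_Un:
  assumes "finite P" "finite Q" "P \<inter> Q = {}"
  shows "(real (card P) + real (card Q)) * avg g (P \<union> Q)
    = real (card P) * avg g P + real (card Q) * avg g Q"
proof -
  have "real (card R) * avg g R = sum g R" if "finite R" for R
    using that by (cases "R = {}") (auto simp: avg_def)
  from this[of P] this[of Q] this[of "P \<union> Q"] show ?thesis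
    using assms by (simp add: sum.union_disjoint card_Un_disjoint)
qed

lemma avg_less_avg_Un_iff:
  assumes "finite P" "finite Q" "P \<noteq> {}" "Q \<noteq> {}" "P \<inter> Q = {}"
  shows "avg g P < avg g (P \<union> Q) \<longleftrightarrow> avg g P < avg g Q"
    and "avg g (P \<union> Q) < avg g Q \<longleftrightarrow> avg g P < avg g Q"
proof -
  define p q where "p = real (card P)" and "q = real (card Q)"
  have "p > 0" "q > 0"
    using assms by (auto simp: p_def q_def card_gt_0_iff)
  then have mean: "avg g (P \<union> Q) = (p * avg g P + q * avg g Q) / (p + q)"
    using avg_Un[OF assms(1,2,5), of g] by (simp add: p_def q_def eq_divide_eq mult.commute)
  show "avg g P < avg g (P \<union> Q) \<longleftrightarrow> avg g P < avg g Q"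
    and "avg g (P \<union> Q) < avg g Q \<longleftrightarrow> avg g P < avg g Q"
    using \<open>p > 0\<close> \<open>q > 0\<close> unfolding mean by (simp_all add: field_simps)
qed

definition distinct_averages :: "('i \<Rightarrow> real) \<Rightarrow> 'i set \<Rightarrow> bool" where
  "distinct_averages g S \<longleftrightarrow>
    (\<forall>P Q. P \<subseteq> S \<and> Q \<subseteq> S \<and> P \<noteq> {} \<and> Q \<noteq> {} \<and> P \<inter> Q = {} \<longrightarrow> avg g P \<noteq> avg g Q)"

lemma distinct_averagesD:
  assumes "distinct_averages g S" "P \<subseteq> S" "Q \<subseteq> S" "P \<noteq> {}" "Q \<noteq> {}" "P \<inter> Q = {}"
  shows "avg g P \<noteq> avg g Q"
  using assms by (simp add: distinct_averages_def)

lemma distinct_averages_subset: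
  "distinct_averages g S \<Longrightarrow> T \<subseteq> S \<Longrightarrow> distinct_averages g T"
  unfolding distinct_averages_def by (meson subset_trans)

definition irreducible_orderings :: "('i \<Rightarrow> real) \<Rightarrow> 'i set \<Rightarrow> 'i list set" where
  "irreducible_orderings g P = {zs \<in> permutations_of_set P.
     \<forall>vs. strict_suffix vs zs \<and> vs \<noteq> [] \<longrightarrow> avg g (set vs) < avg g P}"

definition orderings_below :: "('i \<Rightarrow> real) \<Rightarrow> real \<Rightarrow> 'i set \<Rightarrow> 'i list set" where
  "orderings_below g z S = {xs \<in> permutations_of_set S.
     \<forall>vs. suffix vs xs \<and> vs \<noteq> [] \<longrightarrow> avg g (set vs) < z}"

lemma finite_irreducible_orderings [simp]: "finite (irreducible_orderings g P)"
  unfolding irreducible_orderings_def by simp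

lemma finite_orderings_below [simp]: "finite (orderings_below g z S)"
  unfolding orderings_below_def by simp

lemma irreducible_orderingsD:
  assumes "zs \<in> irreducible_orderings g P"
  shows "set zs = P" "distinct zs"
  using assms by (auto simp: irreducible_orderings_def permutations_of_set_def)

text \<open>Summation by parts: the increments of \<open>w\<close> are weighted by suffix sums of \<open>d\<close>.\<close>

lemma sum_list_mult_sorted_le_hd:
  fixes d w :: "'i \<Rightarrow> real"
  assumes "sorted (map w zs)" "zs \<noteq> []"
    and "\<And>vs. suffix vs zs \<Longrightarrow> (\<Sum>i\<leftarrow>vs. d i) \<le> 0"
  shows "(\<Sum>i\<leftarrow>zs. d i * w i) \<le> w (hd zs) * (\<Sum>i\<leftarrow>zs. d i)"
  using assms
proof (induction zs)
  case (Cons a zs)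
  show ?case
  proof (cases "zs = []")
    case False
    have "(\<Sum>i\<leftarrow>zs. d i * w i) \<le> w (hd zs) * (\<Sum>i\<leftarrow>zs. d i)"
      using Cons False by (intro Cons.IH) (auto simp: suffix_Cons)
    also have "\<dots> \<le> w a * (\<Sum>i\<leftarrow>zs. d i)"
      using Cons.prems False by (intro mult_right_mono_neg) (auto simp: suffix_Cons)
    finally show ?thesis by (simp add: algebra_simps)
  qed simp
qed simp

lemma sum_list_diff_const:
  assumes "distinct vs"
  shows "(\<Sum>i\<leftarrow>vs. g i - m) = real (length vs) * (avg g (set vs) - m)"
  using assms
  by (cases "vs = []")
    (simp_all add: sum_list_subtractf sum_list_triv avg_def distinct_card
      sum_list_distinct_conv_sum_set field_simps)

lemma sum_list_centred_mult_sorted_nonpos: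
  assumes irreducible: "zs \<in> irreducible_orderings g P" and sorted: "sorted (map w zs)"
  shows "(\<Sum>i\<leftarrow>zs. (g i - avg g P) * w i) \<le> 0"
proof (cases "zs = []")
  case False
  have zs: "set zs = P" "distinct zs"
    using irreducible by (rule irreducible_orderingsD)+
  have "(\<Sum>i\<leftarrow>vs. g i - avg g P) \<le> 0" if "suffix vs zs" for vs
  proof -
    have "distinct vs" using that zs(2) by (auto simp: suffix_def)
    moreover have "avg g (set vs) \<le> avg g P" if "vs \<noteq> []"
      using irreducible \<open>suffix vs zs\<close> that zs(1)
      by (cases "vs = zs") (auto simp: irreducible_orderings_def strict_suffix_def less_imp_le)
    ultimately show ?thesis
      by (cases "vs = []") (simp_all add: sum_list_diff_const mult_nonneg_nonpos)
  qed
  with sorted False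
  have "(\<Sum>i\<leftarrow>zs. (g i - avg g P) * w i) \<le> w (hd zs) * (\<Sum>i\<leftarrow>zs. g i - avg g P)"
    by (rule sum_list_mult_sorted_le_hd)
  also have "\<dots> = 0"
    using zs by (simp add: sum_list_diff_const)
  finally show ?thesis .
qed simp

lemma monotone_gain_irreducible_le:
  assumes irreducible: "zs \<in> irreducible_orderings g P"
  shows "monotone_gain g zs \<le> block_gain g P"
proof (rule monotone_gain_le)
  fix w :: "'a \<Rightarrow> real" assume w: "sorted (map w zs)"
  define m where "m = avg g P"
  have "(\<Sum>i\<leftarrow>zs. gain g w i) = (\<Sum>i\<leftarrow>zs. 2 * ((g i - m) * w i) + gain (\<lambda>_. m) w i)"
    by (simp add: gain_def algebra_simps)
  also have "\<dots> = 2 * (\<Sum>i\<leftarrow>zs. (g i - m) * w i) + (\<Sum>i\<leftarrow>zs. gain (\<lambda>_. m) w i)"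
    by (simp add: sum_list_addf sum_list_const_mult)
  also have "\<dots> \<le> 0 + (\<Sum>i\<leftarrow>zs. m\<^sup>2)"
    using sum_list_centred_mult_sorted_nonpos[OF irreducible w]
    by (intro add_mono sum_list_mono gain_le_square) (simp add: m_def)
  also have "\<dots> = real (card P) * m\<^sup>2"
    using irreducible_orderingsD[OF irreducible] by (auto simp: sum_list_triv distinct_card)
  also have "\<dots> = block_gain g P"
    by (simp add: m_def avg_def block_gain_def power2_eq_square)
  finally show "(\<Sum>i\<leftarrow>zs. gain g w i) \<le> block_gain g P" .
qed

definition max_avg_suffix :: "('i \<Rightarrow> real) \<Rightarrow> 'i list \<Rightarrow> 'i list \<Rightarrow> bool" where
  "max_avg_suffix g xs zs \<longleftrightarrow> suffix zs xs \<and> zs \<noteq> [] \<and>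
    (\<forall>vs. suffix vs xs \<and> vs \<noteq> [] \<longrightarrow> avg g (set vs) \<le> avg g (set zs))"

lemma max_avg_suffix_exists:
  assumes "xs \<noteq> []"
  shows "\<exists>zs. max_avg_suffix g xs zs"
proof -
  let ?suffixes = "set (suffixes xs) - {[]}"
  have "xs \<in> ?suffixes" using assms by simp
  then obtain zs where "is_arg_min (\<lambda>vs. - avg g (set vs)) (\<lambda>vs. vs \<in> ?suffixes) zs"
    using ex_is_arg_min_if_finite[of ?suffixes "\<lambda>vs. - avg g (set vs)"] by blast
  then have "max_avg_suffix g xs zs"
    by (simp add: is_arg_min_linorder max_avg_suffix_def)
  then show ?thesis ..
qed

lemma max_avg_suffix_irreducible:
  assumes "distinct xs" "distinct_averages g (set xs)" and zs: "max_avg_suffix g xs zs"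
  shows "zs \<in> irreducible_orderings g (set zs)"
proof -
  have suffix: "suffix zs xs" using zs by (simp add: max_avg_suffix_def)
  have "avg g (set vs) < avg g (set zs)" if vs: "strict_suffix vs zs" "vs \<noteq> []" for vs
  proof -
    obtain us where us: "zs = us @ vs" "us \<noteq> []"
      using vs by (auto simp: strict_suffix_def suffix_def)
    have disjoint: "set us \<inter> set vs = {}"
      using assms(1) suffix us by (auto simp: suffix_def)
    have "suffix vs xs"
      using suffix us suffix_order.trans[of vs zs xs] by (simp add: suffixI)
    then have "\<not> avg g (set us \<union> set vs) < avg g (set vs)"
      using zs us vs by (auto simp: max_avg_suffix_def not_less)
    then have "\<not> avg g (set us) < avg g (set vs)"
      using us vs disjoint by (simp add: avg_less_avg_Un_iff)
    moreover have "avg g (set us) \<noteq> avg g (set vs)"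
      using us vs disjoint set_mono_suffix[OF suffix]
      by (intro distinct_averagesD[OF assms(2)]) auto
    ultimately have "avg g (set vs) < avg g (set us)" by simp
    then have "avg g (set vs) < avg g (set vs \<union> set us)"
      using us vs disjoint by (subst avg_less_avg_Un_iff) auto
    then show ?thesis using us by (simp add: Un_commute)
  qed
  moreover have "distinct zs" using assms(1) suffix by (auto simp: suffix_def)
  ultimately show ?thesis by (auto simp: irreducible_orderings_def permutations_of_set_def)
qed

lemma prefix_of_max_avg_suffix_below:
  assumes "distinct (ys @ zs)" "distinct_averages g (set (ys @ zs))"
    and zs: "max_avg_suffix g (ys @ zs) zs"
  shows "ys \<in> orderings_below g (avg g (set zs)) (set ys)"
proof -
  have "avg g (set us) < avg g (set zs)" if us: "suffix us ys" "us \<noteq> []" for us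
  proof -
    have "zs \<noteq> []" using zs by (simp add: max_avg_suffix_def)
    have disjoint: "set zs \<inter> set us = {}" and sub: "set us \<subseteq> set ys"
      using assms(1) set_mono_suffix[OF us(1)] by auto
    have "suffix (us @ zs) (ys @ zs)" "us @ zs \<noteq> []" using us by simp_all
    then have "avg g (set (us @ zs)) \<le> avg g (set zs)"
      using zs unfolding max_avg_suffix_def by blast
    then have "\<not> avg g (set zs) < avg g (set zs \<union> set us)"
      by (simp add: Un_commute)
    then have "\<not> avg g (set zs) < avg g (set us)"
      using us \<open>zs \<noteq> []\<close> disjoint by (simp add: avg_less_avg_Un_iff)
    moreover have "avg g (set zs) \<noteq> avg g (set us)"
      using us \<open>zs \<noteq> []\<close> disjoint sub by (intro distinct_averagesD[OF assms(2)]) auto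
    ultimately show ?thesis by simp
  qed
  then show ?thesis
    using assms(1) by (auto simp: orderings_below_def permutations_of_set_def)
qed

lemma orderings_below_decomposition:
  assumes "S \<noteq> {}" "distinct_averages g S"
  shows "orderings_below g z S \<subseteq> (\<lambda>(P, zs, ys). ys @ zs) `
    (SIGMA P:{P. P \<subseteq> S \<and> P \<noteq> {} \<and> avg g P < z}.
       irreducible_orderings g P \<times> orderings_below g (avg g P) (S - P))"
proof
  fix xs assume below: "xs \<in> orderings_below g z S"
  then have xs: "set xs = S" "distinct xs"
    by (auto simp: orderings_below_def permutations_of_set_def)
  with assms(1) obtain zs where zs: "max_avg_suffix g xs zs"
    using max_avg_suffix_exists[of xs g] by auto
  then obtain ys where split: "xs = ys @ zs" and "zs \<noteq> []"
    by (auto simp: max_avg_suffix_def suffix_def)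
  have "zs \<in> irreducible_orderings g (set zs)"
    using assms(2) xs zs by (intro max_avg_suffix_irreducible[of xs]) auto
  moreover have "ys \<in> orderings_below g (avg g (set zs)) (set ys)"
    using assms(2) xs zs unfolding split by (intro prefix_of_max_avg_suffix_below) auto
  moreover have "set ys = S - set zs" using xs split by auto
  moreover have "avg g (set zs) < z"
    using below split \<open>zs \<noteq> []\<close> by (auto simp: orderings_below_def suffix_def)
  ultimately show "xs \<in> (\<lambda>(P, zs, ys). ys @ zs) `
    (SIGMA P:{P. P \<subseteq> S \<and> P \<noteq> {} \<and> avg g P < z}.
       irreducible_orderings g P \<times> orderings_below g (avg g P) (S - P))"
    using xs split \<open>zs \<noteq> []\<close> by (intro image_eqI[of _ _ "(set zs, zs, ys)"]) auto
qed

text \<open>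
  Cycle lemma: if \<open>us @ vs\<close> and \<open>vs @ us\<close> were both irreducible, the averages of \<open>us\<close> and of \<open>vs\<close>
  would both lie below the average of their union.
\<close>

lemma irreducible_rotation_unique:
  assumes "zs \<in> irreducible_orderings g P" "rotate d zs \<in> irreducible_orderings g P"
    and "d < length zs"
  shows "d = 0"
proof (rule ccontr)
  assume "d \<noteq> 0"
  define us vs where "us = take d zs" and "vs = drop d zs"
  have split: "zs = us @ vs" "rotate d zs = vs @ us"
    using assms(3) by (simp_all add: us_def vs_def rotate_drop_take)
  have ne: "us \<noteq> []" "vs \<noteq> []"
    using assms(3) \<open>d \<noteq> 0\<close> by (auto simp: us_def vs_def)
  then have "strict_suffix vs zs" "strict_suffix us (rotate d zs)"
    using split by (auto simp: strict_suffix_def suffix_def)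
  then have "avg g (set vs) < avg g P" "avg g (set us) < avg g P"
    using assms(1,2) ne by (auto simp: irreducible_orderings_def)
  moreover have "P = set us \<union> set vs" "set us \<inter> set vs = {}"
    using irreducible_orderingsD[OF assms(1)] split(1) by auto
  ultimately show False
    using avg_less_avg_Un_iff[of "set us" "set vs" g] ne by auto
qed

lemma inj_on_rotate_irreducible:
  "inj_on (\<lambda>(r, zs). rotate r zs) ({..<card P} \<times> irreducible_orderings g P)"
proof -
  have unique: "r = r' \<and> zs = zs'"
    if "zs \<in> irreducible_orderings g P" "zs' \<in> irreducible_orderings g P" "r' < card P" "r \<le> r'"
      "rotate r zs = rotate r' zs'" for r r' zs zs'
  proof -
    have "rotate r zs = rotate r (rotate (r' - r) zs')"
      using that by (simp add: rotate_rotate)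
    moreover have "inj (rotate r :: 'a list \<Rightarrow> 'a list)"
      unfolding rotate_def by (intro inj_fn inj_rotate1)
    ultimately have "zs = rotate (r' - r) zs'" by (simp add: inj_eq)
    moreover have "length zs' = card P"
      using distinct_card[of zs'] irreducible_orderingsD[OF that(2)] by simp
    ultimately have "r' - r = 0"
      using that(1-3) by (intro irreducible_rotation_unique[OF that(2)]) auto
    with \<open>zs = rotate (r' - r) zs'\<close> that(4) show ?thesis by simp
  qed
  show ?thesis
  proof (rule inj_onI, clarify)
    fix r zs r' zs'
    assume "zs \<in> irreducible_orderings g P" "zs' \<in> irreducible_orderings g P"
      "r < card P" "r' < card P" "rotate r zs = rotate r' zs'"
    then show "r = r' \<and> zs = zs'"
      using unique[of zs zs' r' r] unique[of zs' zs r r'] by (cases "r \<le> r'") auto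
  qed
qed

lemma card_irreducible_orderings_le:
  assumes "finite P" "P \<noteq> {}"
  shows "real (card (irreducible_orderings g P)) \<le> fact (card P - 1)"
proof -
  have "(\<lambda>(r, zs). rotate r zs) ` ({..<card P} \<times> irreducible_orderings g P)
      \<subseteq> permutations_of_set P"
    by (auto simp: permutations_of_set_def dest: irreducible_orderingsD)
  with inj_on_rotate_irreducible
  have "card ({..<card P} \<times> irreducible_orderings g P) \<le> card (permutations_of_set P)"
    by (rule card_inj_on_le) simp
  then have "card P * card (irreducible_orderings g P) \<le> card P * fact (card P - 1)"
    using assms by (simp add: card_cartesian_product fact_reduce[of "card P"] card_gt_0_iff)
  then have "card (irreducible_orderings g P) \<le> fact (card P - 1)"
    using assms by (simp add: card_gt_0_iff)
  then have "real (card (irreducible_orderings g P)) \<le> real (fact (card P - 1))"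
    by (simp only: of_nat_le_iff)
  then show ?thesis by simp
qed

section \<open>Sums over set partitions\<close>

lemma partition_on_insert_block:
  assumes "partition_on (S - P) X" "P \<subseteq> S" "P \<noteq> {}"
  shows "partition_on S (insert P X)"
proof -
  have "disjnt P (\<Union>X)" using partition_onD1[OF assms(1)] by (auto simp: disjnt_def)
  then show ?thesis using assms by (simp add: partition_on_insert)
qed

lemma partition_on_block:
  assumes "partition_on S X" "P \<in> X"
  shows "P \<subseteq> S" "P \<noteq> {}"
  using assms by (auto simp: partition_on_def)

lemma partition_on_remove_block:
  assumes "partition_on S X" "P \<in> X"
  shows "partition_on (S - P) (X - {P})"
proof -
  have "disjnt P (\<Union>(X - {P}))"
    using partition_onD2[OF assms(1)] assms(2) by (auto simp: disjnt_def disjoint_def)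
  moreover have "insert P (X - {P}) = X" using assms(2) by blast
  ultimately show ?thesis
    using assms(1) partition_on_insert[of P "X - {P}" S] by simp
qed

lemma partition_on_Diff_notin:
  assumes "partition_on (S - P) X"
  shows "P \<notin> X"
proof
  assume "P \<in> X"
  then have "P = {}" using partition_onD1[OF assms] by blast
  with \<open>P \<in> X\<close> show False using partition_onD3[OF assms] by simp
qed

lemma sum_partitions_marked_block:
  fixes w :: "'i set \<Rightarrow> 'b::comm_semiring_1"
  assumes "finite S"
  shows "(\<Sum>X | partition_on S X. \<Sum>P | P \<in> X \<and> \<phi> P (X - {P}). \<Prod>Q\<in>X. w Q)
    = (\<Sum>P | P \<subseteq> S \<and> P \<noteq> {}. w P * (\<Sum>X | partition_on (S - P) X \<and> \<phi> P X. \<Prod>Q\<in>X. w Q))"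
proof -
  let ?marked = "SIGMA X:{X. partition_on S X}. {P. P \<in> X \<and> \<phi> P (X - {P})}"
  let ?split = "SIGMA P:{P. P \<subseteq> S \<and> P \<noteq> {}}. {X. partition_on (S - P) X \<and> \<phi> P X}"
  have finite_partition: "finite X" if "partition_on T X" "T \<subseteq> S" for X T
    using that finite_elements[of T X] finite_subset[OF _ assms] by blast
  have finite_partitions: "finite {X. partition_on (S - P) X \<and> \<phi> P X}" for P
    using finitely_many_partition_on[of "S - P"] assms by (auto intro: finite_subset[rotated])
  have "(\<Sum>X | partition_on S X. \<Sum>P | P \<in> X \<and> \<phi> P (X - {P}). \<Prod>Q\<in>X. w Q)
    = (\<Sum>(X, P)\<in>?marked. \<Prod>Q\<in>X. w Q)"
    using finitely_many_partition_on[OF assms] finite_partition[of S]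
    by (intro sum.Sigma) auto
  also have "\<dots> = (\<Sum>(P, X)\<in>?split. w P * (\<Prod>Q\<in>X. w Q))"
  proof (rule sum.reindex_bij_witness[where i = "\<lambda>(P, X). (insert P X, P)"
        and j = "\<lambda>(X, P). (P, X - {P})"])
    fix X_P assume "X_P \<in> ?marked"
    then obtain X P where X_P: "X_P = (X, P)" "partition_on S X" "P \<in> X" "\<phi> P (X - {P})" by auto
    then show "(case X_P of (X, P) \<Rightarrow> (P, X - {P})) \<in> ?split"
      using partition_on_remove_block[of S X P] partition_on_block[of S X P] by auto
    show "(case case X_P of (X, P) \<Rightarrow> (P, X - {P}) of (P, X) \<Rightarrow> w P * (\<Prod>Q\<in>X. w Q))
        = (case X_P of (X, P) \<Rightarrow> \<Prod>Q\<in>X. w Q)"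
      using X_P finite_partition[of S X] by (simp add: prod.remove)
  qed (auto dest: partition_on_Diff_notin intro: partition_on_insert_block)
  also have "\<dots> = (\<Sum>P | P \<subseteq> S \<and> P \<noteq> {}. \<Sum>X | partition_on (S - P) X \<and> \<phi> P X. w P * (\<Prod>Q\<in>X. w Q))"
    using assms finite_partitions by (intro sum.Sigma[symmetric]) auto
  finally show ?thesis by (simp add: sum_distrib_left)
qed

lemma sum_over_strict_maximum_le:
  fixes m :: "'p \<Rightarrow> 'm::linorder" and c :: real
  assumes "c \<ge> 0"
  shows "(\<Sum>P | P \<in> X \<and> m P < z \<and> (\<forall>Q\<in>X - {P}. m Q < m P). c)
    \<le> (if \<forall>P\<in>X. m P < z then c else 0)"
proof (cases "\<exists>P\<in>X. m P < z \<and> (\<forall>Q\<in>X - {P}. m Q < m P)")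
  case True
  then obtain P where P: "P \<in> X" "m P < z" "\<And>Q. Q \<in> X - {P} \<Longrightarrow> m Q < m P" by blast
  have "P' = P" if "P' \<in> X" "\<forall>Q\<in>X - {P'}. m Q < m P'" for P'
  proof (rule ccontr)
    assume "P' \<noteq> P"
    then have "m P < m P'" "m P' < m P" using that P by auto
    then show False by simp
  qed
  then have "{P. P \<in> X \<and> m P < z \<and> (\<forall>Q\<in>X - {P}. m Q < m P)} = {P}"
    using P by blast
  moreover have "m Q < z" if "Q \<in> X" for Q
    using P that by (cases "Q = P") (auto intro: order.strict_trans[of _ "m P"])
  ultimately show ?thesis by simp
next
  case False
  then have "{P. P \<in> X \<and> m P < z \<and> (\<forall>Q\<in>X - {P}. m Q < m P)} = {}" by blast
  then show ?thesis using assms by (simp only: sum.empty) simp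
qed

lemma sum_partitions_max_block_le:
  fixes m :: "'i set \<Rightarrow> 'm::linorder" and w :: "'i set \<Rightarrow> real"
  assumes "finite S" and nonneg: "\<And>P. w P \<ge> 0"
  shows "(\<Sum>P | P \<subseteq> S \<and> P \<noteq> {} \<and> m P < z.
      w P * (\<Sum>X | partition_on (S - P) X \<and> (\<forall>Q\<in>X. m Q < m P). \<Prod>Q\<in>X. w Q))
    \<le> (\<Sum>X | partition_on S X \<and> (\<forall>P\<in>X. m P < z). \<Prod>P\<in>X. w P)"
proof -
  let ?max = "\<lambda>P X. m P < z \<and> (\<forall>Q\<in>X. m Q < m P)"
  have "(\<Sum>P | P \<subseteq> S \<and> P \<noteq> {} \<and> m P < z.
      w P * (\<Sum>X | partition_on (S - P) X \<and> (\<forall>Q\<in>X. m Q < m P). \<Prod>Q\<in>X. w Q))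
    = (\<Sum>P | P \<subseteq> S \<and> P \<noteq> {}. w P * (\<Sum>X | partition_on (S - P) X \<and> ?max P X. \<Prod>Q\<in>X. w Q))"
  proof (intro sum.mono_neutral_cong_left ballI)
    fix P assume "P \<in> {P. P \<subseteq> S \<and> P \<noteq> {}} - {P. P \<subseteq> S \<and> P \<noteq> {} \<and> m P < z}"
    then have "\<not> m P < z" by blast
    then show "w P * (\<Sum>X | partition_on (S - P) X \<and> ?max P X. \<Prod>Q\<in>X. w Q) = 0" by simp
  qed (use assms(1) in auto)
  also have "\<dots> = (\<Sum>X | partition_on S X. \<Sum>P | P \<in> X \<and> ?max P (X - {P}). \<Prod>Q\<in>X. w Q)"
    by (rule sum_partitions_marked_block[OF assms(1), symmetric])
  also have "\<dots> \<le> (\<Sum>X | partition_on S X. if \<forall>P\<in>X. m P < z then \<Prod>P\<in>X. w P else 0)"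
    by (intro sum_mono sum_over_strict_maximum_le prod_nonneg nonneg)
  also have "\<dots> = (\<Sum>X | partition_on S X \<and> (\<forall>P\<in>X. m P < z). \<Prod>P\<in>X. w P)"
    using finitely_many_partition_on[OF assms(1)] by (simp add: sum.inter_filter[symmetric])
  finally show ?thesis .
qed

lemma sum_Pow_pochhammer:
  fixes a b :: "'b::comm_ring_1"
  assumes "finite A"
  shows "(\<Sum>Q\<in>Pow A. pochhammer a (card Q) * pochhammer b (card (A - Q)))
    = pochhammer (a + b) (card A)"
proof -
  let ?h = "\<lambda>j. pochhammer a j * pochhammer b (card A - j)"
  have "(\<Sum>Q\<in>Pow A. pochhammer a (card Q) * pochhammer b (card (A - Q))) = (\<Sum>Q\<in>Pow A. ?h (card Q))"
    using assms by (intro sum.cong) (auto simp: card_Diff_subset finite_subset)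
  also have "\<dots> = (\<Sum>j\<le>card A. \<Sum>Q\<in>{Q \<in> Pow A. card Q = j}. ?h (card Q))"
    using assms by (intro sum.group[symmetric]) (auto intro: card_mono)
  also have "\<dots> = (\<Sum>j\<le>card A. of_nat (card A choose j) * ?h j)"
    using n_subsets[OF assms] by (intro sum.cong) auto
  finally show ?thesis by (simp add: pochhammer_binomial_sum mult.assoc)
qed

lemma sum_partitions_insert:
  fixes w :: "'i set \<Rightarrow> 'b::comm_semiring_1"
  assumes "finite A" "a \<notin> A"
  shows "(\<Sum>X | partition_on (insert a A) X. \<Prod>P\<in>X. w P)
    = (\<Sum>Q\<in>Pow A. w (insert a Q) * (\<Sum>X | partition_on (A - Q) X. \<Prod>P\<in>X. w P))"
proof -
  let ?S = "insert a A"
  have "(\<Sum>X | partition_on ?S X. \<Prod>P\<in>X. w P)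
      = (\<Sum>X | partition_on ?S X. \<Sum>P | P \<in> X \<and> a \<in> P. \<Prod>P\<in>X. w P)"
  proof (rule sum.cong[OF refl])
    fix X assume "X \<in> {X. partition_on ?S X}"
    then have X: "partition_on ?S X" by simp
    then obtain P where "P \<in> X" "a \<in> P"
      using partition_onD1[OF X] by blast
    then have "{P. P \<in> X \<and> a \<in> P} = {P}"
      using disjointD[OF partition_onD2[OF X]] by blast
    then show "(\<Prod>P\<in>X. w P) = (\<Sum>P | P \<in> X \<and> a \<in> P. \<Prod>P\<in>X. w P)" by simp
  qed
  also have "\<dots> = (\<Sum>P | P \<subseteq> ?S \<and> P \<noteq> {}. w P * (\<Sum>X | partition_on (?S - P) X \<and> a \<in> P. \<Prod>P\<in>X. w P))"
    using assms(1) by (intro sum_partitions_marked_block[where \<phi> = "\<lambda>P _. a \<in> P"]) simp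
  also have "\<dots> = (\<Sum>P | P \<subseteq> ?S \<and> a \<in> P. w P * (\<Sum>X | partition_on (?S - P) X. \<Prod>P\<in>X. w P))"
  proof (intro sum.mono_neutral_cong_right ballI)
    fix P assume "P \<in> {P. P \<subseteq> ?S \<and> P \<noteq> {}} - {P. P \<subseteq> ?S \<and> a \<in> P}"
    then have "a \<notin> P" by blast
    then show "w P * (\<Sum>X | partition_on (?S - P) X \<and> a \<in> P. \<Prod>P\<in>X. w P) = 0" by simp
  qed (use assms(1) in auto)
  also have "\<dots> = (\<Sum>Q\<in>Pow A. w (insert a Q) * (\<Sum>X | partition_on (?S - insert a Q) X. \<Prod>P\<in>X. w P))"
    using assms(2)
    by (intro sum.reindex_bij_witness[where i = "insert a" and j = "\<lambda>P. P - {a}"])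
      (auto simp: insert_absorb)
  also have "\<dots> = (\<Sum>Q\<in>Pow A. w (insert a Q) * (\<Sum>X | partition_on (A - Q) X. \<Prod>P\<in>X. w P))"
    using assms(2) by (simp add: insert_Diff_if flip: Diff_insert2)
  finally show ?thesis .
qed

text \<open>Weighting a block \<open>P\<close> by \<open>(|P| - 1)!\<close> counts permutations by their number of cycles.\<close>

lemma sum_partitions_prod_fact:
  fixes y :: "'b::{idom, ring_char_0}"
  assumes "finite S"
  shows "(\<Sum>X | partition_on S X. \<Prod>P\<in>X. y * fact (card P - 1)) = pochhammer y (card S)"
  using assms
proof (induction "card S" arbitrary: S rule: less_induct)
  case less
  show ?case
  proof (cases "S = {}")
    case True
    moreover have "{X :: 'a set set. partition_on {} X} = {{}}" by (auto simp: partition_on_empty)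
    ultimately show ?thesis by simp
  next
    case False
    then obtain a A where S: "S = insert a A" "a \<notin> A" by (metis mk_disjoint_insert equals0I)
    have "finite A" using less.prems S by simp
    let ?w = "\<lambda>P :: 'a set. y * fact (card P - 1)"
    have "(\<Sum>X | partition_on S X. \<Prod>P\<in>X. ?w P)
        = (\<Sum>Q\<in>Pow A. ?w (insert a Q) * (\<Sum>X | partition_on (A - Q) X. \<Prod>P\<in>X. ?w P))"
      unfolding S(1) using \<open>finite A\<close> S(2) by (rule sum_partitions_insert)
    also have "\<dots> = (\<Sum>Q\<in>Pow A. y * (pochhammer 1 (card Q) * pochhammer y (card (A - Q))))"
    proof (rule sum.cong[OF refl])
      fix Q assume "Q \<in> Pow A"
      then have "finite Q" "a \<notin> Q"
        using S \<open>finite A\<close> by (auto intro: finite_subset)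
      moreover have "(\<Sum>X | partition_on (A - Q) X. \<Prod>P\<in>X. ?w P) = pochhammer y (card (A - Q))"
        using S \<open>finite A\<close> by (intro less.hyps) (auto intro!: le_imp_less_Suc card_mono)
      ultimately show "?w (insert a Q) * (\<Sum>X | partition_on (A - Q) X. \<Prod>P\<in>X. ?w P)
          = y * (pochhammer 1 (card Q) * pochhammer y (card (A - Q)))"
        by (simp add: pochhammer_fact[symmetric] mult.assoc)
    qed
    also have "\<dots> = y * pochhammer (1 + y) (card A)"
      using \<open>finite A\<close> by (simp add: sum_Pow_pochhammer flip: sum_distrib_left)
    also have "\<dots> = pochhammer y (card S)"
      using S \<open>finite A\<close> by (simp add: pochhammer_rec add.commute)
    finally show ?thesis .
  qed
qed

definition block_weight :: "real \<Rightarrow> ('i \<Rightarrow> real) \<Rightarrow> 'i set \<Rightarrow> real" where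
  "block_weight s g P = fact (card P - 1) * exp (s * block_gain g P)"

lemma block_weight_nonneg [simp]: "block_weight s g P \<ge> 0"
  by (simp add: block_weight_def)

lemma sum_orderings_below_le:
  assumes "finite S" "S \<noteq> {}" "distinct_averages g S" "s \<ge> 0"
  shows "(\<Sum>xs\<in>orderings_below g z S. exp (s * monotone_gain g xs))
    \<le> (\<Sum>P | P \<subseteq> S \<and> P \<noteq> {} \<and> avg g P < z. block_weight s g P *
         (\<Sum>ys\<in>orderings_below g (avg g P) (S - P). exp (s * monotone_gain g ys)))"
proof -
  let ?Ps = "{P. P \<subseteq> S \<and> P \<noteq> {} \<and> avg g P < z}"
  let ?Zs = "irreducible_orderings g"
  let ?Ys = "\<lambda>P. orderings_below g (avg g P) (S - P)"
  let ?weight = "\<lambda>ys. exp (s * monotone_gain g ys)"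
  let ?T = "SIGMA P:?Ps. ?Zs P \<times> ?Ys P"
  have finite: "finite ?Ps" "finite ?T" using assms(1) by auto
  have "(\<Sum>xs\<in>orderings_below g z S. ?weight xs) \<le> sum ?weight ((\<lambda>(P, zs, ys). ys @ zs) ` ?T)"
    using finite orderings_below_decomposition[OF assms(2,3)] by (intro sum_mono2) auto
  also have "\<dots> \<le> (\<Sum>(P, zs, ys)\<in>?T. ?weight (ys @ zs))"
    using sum_image_le[OF finite(2), of ?weight "\<lambda>(P, zs, ys). ys @ zs"]
    by (simp add: comp_def case_prod_unfold)
  also have "\<dots> \<le> (\<Sum>(P, zs, ys)\<in>?T. exp (s * block_gain g P) * ?weight ys)"
  proof (rule sum_mono, clarify)
    fix P zs ys assume "zs \<in> ?Zs P"
    then have "monotone_gain g (ys @ zs) \<le> block_gain g P + monotone_gain g ys"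
      using monotone_gain_append_le[of g ys zs] monotone_gain_irreducible_le[of zs g P] by simp
    from mult_left_mono[OF this assms(4)]
    show "?weight (ys @ zs) \<le> exp (s * block_gain g P) * ?weight ys"
      by (simp add: distrib_left flip: exp_add)
  qed
  also have "\<dots> = (\<Sum>P\<in>?Ps. \<Sum>(zs, ys)\<in>?Zs P \<times> ?Ys P. exp (s * block_gain g P) * ?weight ys)"
    using finite(1) by (subst sum.Sigma) auto
  also have "\<dots> = (\<Sum>P\<in>?Ps. real (card (?Zs P)) * exp (s * block_gain g P) * (\<Sum>ys\<in>?Ys P. ?weight ys))"
    by (simp add: sum.cartesian_product[symmetric] sum_distrib_left mult.assoc)
  also have "\<dots> \<le> (\<Sum>P\<in>?Ps. block_weight s g P * (\<Sum>ys\<in>?Ys P. ?weight ys))"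
  proof (intro sum_mono mult_right_mono sum_nonneg)
    fix P assume "P \<in> ?Ps"
    then have "real (card (?Zs P)) \<le> fact (card P - 1)"
      using assms(1) by (intro card_irreducible_orderings_le) (auto intro: finite_subset)
    then show "real (card (?Zs P)) * exp (s * block_gain g P) \<le> block_weight s g P"
      unfolding block_weight_def by (rule mult_right_mono) simp
  qed auto
  finally show ?thesis .
qed

lemma sum_orderings_below_le_sum_partitions:
  assumes "finite S" "distinct_averages g S" "s \<ge> 0"
  shows "(\<Sum>xs\<in>orderings_below g z S. exp (s * monotone_gain g xs))
    \<le> (\<Sum>X | partition_on S X \<and> (\<forall>P\<in>X. avg g P < z). \<Prod>P\<in>X. block_weight s g P)"
  using assms(1,2)
proof (induction "card S" arbitrary: S z rule: less_induct)
  case less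
  show ?case
  proof (cases "S = {}")
    case True
    have "{X. partition_on {} X \<and> (\<forall>P\<in>X. avg g P < z)} = {{}}"
      by (auto simp: partition_on_empty)
    moreover have "orderings_below g z {} = {[]}"
      by (auto simp: orderings_below_def)
    ultimately show ?thesis using True by simp
  next
    case False
    have "(\<Sum>xs\<in>orderings_below g z S. exp (s * monotone_gain g xs))
      \<le> (\<Sum>P | P \<subseteq> S \<and> P \<noteq> {} \<and> avg g P < z. block_weight s g P *
           (\<Sum>ys\<in>orderings_below g (avg g P) (S - P). exp (s * monotone_gain g ys)))"
      using less.prems False assms(3) by (intro sum_orderings_below_le)
    also have "\<dots> \<le> (\<Sum>P | P \<subseteq> S \<and> P \<noteq> {} \<and> avg g P < z. block_weight s g P *
        (\<Sum>X | partition_on (S - P) X \<and> (\<forall>Q\<in>X. avg g Q < avg g P). \<Prod>Q\<in>X. block_weight s g Q))"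
    proof (intro sum_mono mult_left_mono block_weight_nonneg less.hyps)
      fix P assume "P \<in> {P. P \<subseteq> S \<and> P \<noteq> {} \<and> avg g P < z}"
      then show "card (S - P) < card S"
        using less.prems by (intro psubset_card_mono) auto
      show "finite (S - P)" "distinct_averages g (S - P)"
        using less.prems by (auto intro: distinct_averages_subset)
    qed
    also have "\<dots> \<le> (\<Sum>X | partition_on S X \<and> (\<forall>P\<in>X. avg g P < z). \<Prod>P\<in>X. block_weight s g P)"
      using less.prems by (intro sum_partitions_max_block_le block_weight_nonneg)
    finally show ?thesis .
  qed
qed

lemma sum_permutations_exp_monotone_gain_le:
  assumes "finite S" "distinct_averages g S" "s \<ge> 0"
  shows "(\<Sum>xs\<in>permutations_of_set S. exp (s * monotone_gain g xs))
    \<le> (\<Sum>X | partition_on S X. \<Prod>P\<in>X. block_weight s g P)"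
proof -
  define z where "z = Max (avg g ` Pow S) + 1"
  have z: "avg g P < z" if "P \<subseteq> S" for P
  proof -
    have "avg g P \<le> Max (avg g ` Pow S)" using that assms(1) by (intro Max_ge) auto
    then show ?thesis by (simp add: z_def)
  qed
  have "orderings_below g z S = permutations_of_set S"
    using z by (auto simp: orderings_below_def permutations_of_set_def dest!: set_mono_suffix)
  moreover have "{X. partition_on S X \<and> (\<forall>P\<in>X. avg g P < z)} = {X. partition_on S X}"
    using z by (auto simp: partition_on_def)
  ultimately show ?thesis
    using sum_orderings_below_le_sum_partitions[OF assms, of z] by simp
qed

section \<open>Functions of independent random variables\<close>

definition depends_only_on :: "(('i \<Rightarrow> 'b) \<Rightarrow> 'c) \<Rightarrow> 'i set \<Rightarrow> bool" where
  "depends_only_on F S \<longleftrightarrow> (\<forall>g h. (\<forall>i\<in>S. g i = h i) \<longrightarrow> F g = F h)"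

lemma depends_only_on_restrict: "depends_only_on F S \<Longrightarrow> F (restrict g S) = F g"
  by (simp add: depends_only_on_def)

lemma depends_only_on_compose: "depends_only_on F S \<Longrightarrow> depends_only_on (\<lambda>g. f (F g)) S"
  unfolding depends_only_on_def by (intro allI impI arg_cong[where f = f]) blast

lemma measurable_PiM_borel_fun:
  "(\<lambda>g. g) \<in> measurable (PiM S (\<lambda>_ :: 'i::countable. borel))
    (borel :: ('i \<Rightarrow> 'b::second_countable_topology) measure)"
proof (rule measurable_coordinatewise_then_product)
  fix i :: 'i
  show "(\<lambda>g. g i) \<in> borel_measurable (PiM S (\<lambda>_. borel :: 'b measure))"
  proof (cases "i \<in> S")
    case False
    then have "g i = undefined" if "g \<in> space (PiM S (\<lambda>_. borel :: 'b measure))" for g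
      using that by (auto simp: space_PiM PiE_def extensional_def)
    then show ?thesis by (subst measurable_cong[where g = "\<lambda>_. undefined"]) auto
  qed simp
qed

lemma measurable_depends_only_on:
  fixes \<xi> :: "'i::countable \<Rightarrow> 'a \<Rightarrow> 'b::second_countable_topology"
  assumes "F \<in> measurable borel N" "depends_only_on F S"
    and "\<And>i. i \<in> S \<Longrightarrow> \<xi> i \<in> borel_measurable M"
  shows "(\<lambda>\<omega>. F (\<lambda>i. \<xi> i \<omega>)) \<in> measurable M N"
proof -
  have "(\<lambda>\<omega>. restrict (\<lambda>i. \<xi> i \<omega>) S) \<in> measurable M (PiM S (\<lambda>_. borel))"
    using assms(3) by (rule measurable_restrict)
  from measurable_compose[OF this measurable_compose[OF measurable_PiM_borel_fun assms(1)]]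
  show ?thesis by (simp add: depends_only_on_restrict[OF assms(2)])
qed

context prob_space
begin

lemma nn_integral_prod_depends_only_on:
  fixes \<xi> :: "'i::countable \<Rightarrow> 'a \<Rightarrow> 'b::second_countable_topology"
    and F :: "'j \<Rightarrow> ('i \<Rightarrow> 'b) \<Rightarrow> ennreal"
  assumes "indep_vars (\<lambda>_. borel) \<xi> I" "finite J" "\<And>j. j \<in> J \<Longrightarrow> K j \<subseteq> I"
    and "disjoint_family_on K J"
    and F: "\<And>j. j \<in> J \<Longrightarrow> F j \<in> borel_measurable borel"
      "\<And>j. j \<in> J \<Longrightarrow> depends_only_on (F j) (K j)"
  shows "(\<integral>\<^sup>+\<omega>. (\<Prod>j\<in>J. F j (\<lambda>i. \<xi> i \<omega>)) \<partial>M) = (\<Prod>j\<in>J. \<integral>\<^sup>+\<omega>. F j (\<lambda>i. \<xi> i \<omega>) \<partial>M)"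
proof -
  have "indep_vars (\<lambda>j. PiM (K j) (\<lambda>_. borel)) (\<lambda>j \<omega>. restrict (\<lambda>i. \<xi> i \<omega>) (K j)) J"
    using assms by (intro indep_vars_restrict) auto
  then have "indep_vars (\<lambda>_. borel) (\<lambda>j \<omega>. F j (restrict (\<lambda>i. \<xi> i \<omega>) (K j))) J"
    by (rule indep_vars_compose2) (use measurable_compose[OF measurable_PiM_borel_fun F(1)] in simp)
  then have "(\<integral>\<^sup>+\<omega>. (\<Prod>j\<in>J. F j (restrict (\<lambda>i. \<xi> i \<omega>) (K j))) \<partial>M)
      = (\<Prod>j\<in>J. \<integral>\<^sup>+\<omega>. F j (restrict (\<lambda>i. \<xi> i \<omega>) (K j)) \<partial>M)"
    using assms(2) by (intro indep_vars_nn_integral) auto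
  then show ?thesis by (simp add: depends_only_on_restrict[OF F(2)] cong: prod.cong)
qed

lemma nn_integral_prod_partition:
  fixes \<xi> :: "'i::countable \<Rightarrow> 'a \<Rightarrow> 'b::second_countable_topology"
    and F :: "'i set \<Rightarrow> ('i \<Rightarrow> 'b) \<Rightarrow> ennreal"
  assumes "indep_vars (\<lambda>_. borel) \<xi> I" "S \<subseteq> I" "finite S" and X: "partition_on S X"
    and "\<And>P. P \<in> X \<Longrightarrow> F P \<in> borel_measurable borel"
    and "\<And>P. P \<in> X \<Longrightarrow> depends_only_on (F P) P"
  shows "(\<integral>\<^sup>+\<omega>. (\<Prod>P\<in>X. F P (\<lambda>i. \<xi> i \<omega>)) \<partial>M) = (\<Prod>P\<in>X. \<integral>\<^sup>+\<omega>. F P (\<lambda>i. \<xi> i \<omega>) \<partial>M)"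
proof (rule nn_integral_prod_depends_only_on[where K = "\<lambda>P. P"])
  show "finite X" using assms(3) X by (rule finite_elements)
  show "disjoint_family_on (\<lambda>P. P) X"
    using partition_onD2[OF X] by (auto simp: disjoint_family_on_def disjoint_def)
  show "P \<subseteq> I" if "P \<in> X" for P
    using partition_on_block(1)[OF X that] assms(2) by blast
qed (use assms in auto)

lemma nn_integral_mult_depends_only_on:
  fixes \<xi> :: "'i::countable \<Rightarrow> 'a \<Rightarrow> 'b::second_countable_topology"
    and F G :: "('i \<Rightarrow> 'b) \<Rightarrow> ennreal"
  assumes "indep_vars (\<lambda>_. borel) \<xi> I" "S \<subseteq> I" "T \<subseteq> I" "S \<inter> T = {}"
    and "F \<in> borel_measurable borel" "depends_only_on F S"
    and "G \<in> borel_measurable borel" "depends_only_on G T"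
  shows "(\<integral>\<^sup>+\<omega>. F (\<lambda>i. \<xi> i \<omega>) * G (\<lambda>i. \<xi> i \<omega>) \<partial>M)
    = (\<integral>\<^sup>+\<omega>. F (\<lambda>i. \<xi> i \<omega>) \<partial>M) * (\<integral>\<^sup>+\<omega>. G (\<lambda>i. \<xi> i \<omega>) \<partial>M)"
proof -
  have "(\<integral>\<^sup>+\<omega>. (\<Prod>b\<in>UNIV. (if b then F else G) (\<lambda>i. \<xi> i \<omega>)) \<partial>M)
      = (\<Prod>b\<in>UNIV. \<integral>\<^sup>+\<omega>. (if b then F else G) (\<lambda>i. \<xi> i \<omega>) \<partial>M)"
    using assms
    by (intro nn_integral_prod_depends_only_on[where K = "\<lambda>b. if b then S else T"])
      (auto simp: disjoint_family_on_def)
  then show ?thesis by (simp add: UNIV_bool mult.commute)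
qed

lemma indep_vars_reindex:
  assumes "indep_vars M' X I" "inj_on p J" "p ` J \<subseteq> I"
  shows "indep_vars (\<lambda>j. M' (p j)) (\<lambda>j. X (p j)) J"
proof -
  have "indep_vars (\<lambda>j. PiM {p j} M') (\<lambda>j \<omega>. restrict (\<lambda>i. X i \<omega>) {p j}) J"
    using assms by (intro indep_vars_restrict) (auto simp: disjoint_family_on_def inj_on_def)
  then have "indep_vars (\<lambda>j. M' (p j)) (\<lambda>j \<omega>. (restrict (\<lambda>i. X i \<omega>) {p j}) (p j)) J"
    by (rule indep_vars_compose2) simp
  then show ?thesis by simp
qed

lemma distr_reindex_iid:
  assumes indep: "indep_vars (\<lambda>_. N) \<xi> I" and marginal: "\<And>i. i \<in> I \<Longrightarrow> distr M N (\<xi> i) = D"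
    and p: "inj_on p J" "p ` J \<subseteq> I" and "J \<noteq> {}"
  shows "distr M (PiM J (\<lambda>_. N)) (\<lambda>\<omega>. \<lambda>j\<in>J. \<xi> (p j) \<omega>) = PiM J (\<lambda>_. D)"
proof -
  have "indep_vars (\<lambda>_. N) (\<lambda>j. \<xi> (p j)) J"
    using indep p by (rule indep_vars_reindex)
  moreover from this have "random_variable N (\<xi> (p j))" if "j \<in> J" for j
    using that by (auto simp: indep_vars_def)
  ultimately have "distr M (PiM J (\<lambda>_. N)) (\<lambda>\<omega>. \<lambda>j\<in>J. \<xi> (p j) \<omega>) = PiM J (\<lambda>j. distr M N (\<xi> (p j)))"
    using indep_vars_iff_distr_eq_PiM'[OF \<open>J \<noteq> {}\<close>, where M' = "\<lambda>_. N" and X = "\<lambda>j. \<xi> (p j)"]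
    by simp
  also have "\<dots> = PiM J (\<lambda>_. D)"
    using marginal p(2) by (intro PiM_cong) auto
  finally show ?thesis .
qed

lemma nn_integral_iid_exchangeable:
  fixes \<xi> :: "'i \<Rightarrow> 'a \<Rightarrow> 'b::second_countable_topology"
    and F :: "('j::countable \<Rightarrow> 'b) \<Rightarrow> ennreal"
  assumes indep: "indep_vars (\<lambda>_. borel) \<xi> I"
    and marginal: "\<And>i. i \<in> I \<Longrightarrow> distr M borel (\<xi> i) = D"
    and p: "inj_on p J" "p ` J \<subseteq> I" and q: "inj_on q J" "q ` J \<subseteq> I"
    and F: "F \<in> borel_measurable borel" "depends_only_on F J"
  shows "(\<integral>\<^sup>+\<omega>. F (\<lambda>j. \<xi> (p j) \<omega>) \<partial>M) = (\<integral>\<^sup>+\<omega>. F (\<lambda>j. \<xi> (q j) \<omega>) \<partial>M)"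
proof (cases "J = {}")
  case True
  then have "F (\<lambda>j. \<xi> (p j) \<omega>) = F (\<lambda>j. \<xi> (q j) \<omega>)" for \<omega>
    using F(2) by (auto simp: depends_only_on_def)
  then show ?thesis by simp
next
  case False
  have "(\<integral>\<^sup>+\<omega>. F (\<lambda>j. \<xi> (r j) \<omega>) \<partial>M) = integral\<^sup>N (PiM J (\<lambda>_. D)) F"
    if r: "inj_on r J" "r ` J \<subseteq> I" for r
  proof -
    have "(\<lambda>\<omega>. \<lambda>j\<in>J. \<xi> (r j) \<omega>) \<in> measurable M (PiM J (\<lambda>_. borel))"
      using indep r(2) by (intro measurable_restrict) (auto simp: indep_vars_def)
    then have "(\<integral>\<^sup>+\<omega>. F (\<lambda>j\<in>J. \<xi> (r j) \<omega>) \<partial>M)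
        = integral\<^sup>N (distr M (PiM J (\<lambda>_. borel)) (\<lambda>\<omega>. \<lambda>j\<in>J. \<xi> (r j) \<omega>)) F"
      using measurable_compose[OF measurable_PiM_borel_fun F(1)] by (subst nn_integral_distr) auto
    then show ?thesis
      by (simp add: distr_reindex_iid[OF indep marginal r False] depends_only_on_restrict[OF F(2)])
  qed
  from this[OF p] this[OF q] show ?thesis by simp
qed

end

section \<open>Exponential moments under Gaussian noise\<close>

lemma borel_measurable_monotone_gain [measurable]:
  "(\<lambda>g :: 'i \<Rightarrow> real. monotone_gain g xs) \<in> borel_measurable borel"
proof (subst borel_measurable_iff_greater, intro allI)
  fix a :: real
  have "continuous_on UNIV (\<lambda>g :: 'i \<Rightarrow> real. \<Sum>i\<leftarrow>xs. gain g w i)" for w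
    unfolding gain_def by (induction xs) (auto intro!: continuous_intros)
  then have "open (\<Union>w\<in>{w. sorted (map w xs)}. {g. a < (\<Sum>i\<leftarrow>xs. gain g w i)})"
    by (intro open_UN ballI open_Collect_less continuous_on_const)
  also have "(\<Union>w\<in>{w. sorted (map w xs)}. {g. a < (\<Sum>i\<leftarrow>xs. gain g w i)})
      = {g. a < monotone_gain g xs}"
    using ex_sorted_map[of xs] unfolding monotone_gain_def
    by (subst less_cSUP_iff[OF _ bdd_above_sum_list_gain]) auto
  finally show "{g \<in> space borel. a < monotone_gain g xs} \<in> sets borel"
    by simp
qed

lemma depends_only_on_monotone_gain: "depends_only_on (\<lambda>g. monotone_gain g xs) (set xs)"
  unfolding depends_only_on_def by (auto intro: monotone_gain_cong)

lemma nn_integral_normal_density_exp_square: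
  assumes "\<tau> > 0" "2 * a * \<tau>\<^sup>2 < 1"
  shows "(\<integral>\<^sup>+x. ennreal (normal_density 0 \<tau> x) * ennreal (exp (a * x\<^sup>2)) \<partial>lborel)
    = ennreal (1 / sqrt (1 - 2 * a * \<tau>\<^sup>2))"
proof -
  define r where "r = sqrt (1 - 2 * a * \<tau>\<^sup>2)"
  have r: "r > 0" "r\<^sup>2 = 1 - 2 * a * \<tau>\<^sup>2" using assms(2) by (simp_all add: r_def)
  have "normal_density 0 \<tau> x * exp (a * x\<^sup>2) = 1 / r * normal_density 0 (\<tau> / r) x" for x
  proof -
    have "exp (- (x\<^sup>2 / (2 * \<tau>\<^sup>2))) * exp (a * x\<^sup>2) = exp (- (x\<^sup>2 * r\<^sup>2 / (2 * \<tau>\<^sup>2)))"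
      using assms(1) unfolding r(2) by (simp add: field_simps flip: exp_add)
    then show ?thesis
      using assms(1) r(1)
      by (simp add: normal_density_def power_divide real_sqrt_divide real_sqrt_mult field_simps)
  qed
  then have "(\<integral>\<^sup>+x. ennreal (normal_density 0 \<tau> x) * ennreal (exp (a * x\<^sup>2)) \<partial>lborel)
     = (\<integral>\<^sup>+x. ennreal (1 / r) * ennreal (normal_density 0 (\<tau> / r) x) \<partial>lborel)"
    using r(1) by (simp flip: ennreal_mult)
  also have "\<dots> = ennreal (1 / r) * (\<integral>\<^sup>+x. ennreal (normal_density 0 (\<tau> / r) x) \<partial>lborel)"
    by (rule nn_integral_cmult) simp
  also have "(\<integral>\<^sup>+x. ennreal (normal_density 0 (\<tau> / r) x) \<partial>lborel) = 1"
    using assms(1) r(1) by (subst nn_integral_eq_integral) auto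
  finally show ?thesis by (simp add: r_def)
qed

lemma pochhammer_mono:
  fixes a b :: "'a::linordered_semidom"
  assumes "0 \<le> a" "a \<le> b"
  shows "pochhammer a n \<le> pochhammer b n"
  using assms by (auto simp: pochhammer_prod intro!: prod_mono)

locale gaussian_noise = prob_space +
  fixes \<xi> :: "'i::countable \<Rightarrow> 'a \<Rightarrow> real" and I :: "'i set" and \<sigma> :: real
  assumes finite_I: "finite I" and sigma_pos: "\<sigma> > 0"
    and indep: "indep_vars (\<lambda>_. borel) \<xi> I"
    and normal: "\<And>i. i \<in> I \<Longrightarrow> distributed M lborel (\<xi> i) (normal_density 0 \<sigma>)"
begin

lemma measurable_noise: "i \<in> I \<Longrightarrow> \<xi> i \<in> borel_measurable M"
  using indep by (auto simp: indep_vars_def)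

lemma distr_noise: "i \<in> I \<Longrightarrow> distr M borel (\<xi> i) = density lborel (normal_density 0 \<sigma>)"
  using distributed_distr_eq_density[OF normal] by (simp cong: distr_cong)

lemma nn_integral_exp_block_gain:
  assumes "P \<subseteq> I" "P \<noteq> {}" "2 * s * \<sigma>\<^sup>2 < 1"
  shows "(\<integral>\<^sup>+\<omega>. exp (s * block_gain (\<lambda>i. \<xi> i \<omega>) P) \<partial>M) = ennreal (1 / sqrt (1 - 2 * s * \<sigma>\<^sup>2))"
proof -
  have "finite P" using assms(1) finite_I by (rule finite_subset)
  then have card: "real (card P) > 0" using assms(2) by (simp add: card_gt_0_iff)
  define \<tau> where "\<tau> = sqrt (\<Sum>i\<in>P. \<sigma>\<^sup>2)"
  have \<tau>: "\<tau>\<^sup>2 = real (card P) * \<sigma>\<^sup>2" "\<tau> > 0"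
    using card sigma_pos by (simp_all add: \<tau>_def)
  have variance: "2 * (s / real (card P)) * \<tau>\<^sup>2 = 2 * s * \<sigma>\<^sup>2"
    using card by (simp add: \<tau>(1))
  have "distributed M lborel (\<lambda>\<omega>. \<Sum>i\<in>P. \<xi> i \<omega>) (normal_density (\<Sum>i\<in>P. 0) \<tau>)"
    unfolding \<tau>_def using assms \<open>finite P\<close> sigma_pos normal
    by (intro sum_indep_normal indep_vars_subset[OF indep]) auto
  then have "distributed M lborel (\<lambda>\<omega>. \<Sum>i\<in>P. \<xi> i \<omega>) (normal_density 0 \<tau>)" by simp
  from distributed_nn_integral[OF this, of "\<lambda>x. ennreal (exp (s / real (card P) * x\<^sup>2))"]
  show ?thesis
    using nn_integral_normal_density_exp_square[of \<tau> "s / real (card P)"] variance assms(3) \<tau>(2)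
    by (simp add: block_gain_def)
qed

lemma AE_sum_mult_neq_0:
  assumes "P \<subseteq> I" "P \<noteq> {}" "\<And>i. i \<in> P \<Longrightarrow> c i \<noteq> 0"
  shows "AE \<omega> in M. (\<Sum>i\<in>P. c i * \<xi> i \<omega>) \<noteq> 0"
proof -
  have "distributed M lborel (\<lambda>\<omega>. 0 + c i * \<xi> i \<omega>) (normal_density (0 + c i * 0) (\<bar>c i\<bar> * \<sigma>))"
    if "i \<in> P" for i
    using that assms sigma_pos by (intro normal_density_affine normal) auto
  moreover have "indep_vars (\<lambda>_. borel) (\<lambda>i \<omega>. c i * \<xi> i \<omega>) P"
    using assms(1) by (intro indep_vars_compose2[OF indep_vars_subset[OF indep]]) auto
  ultimately have "distributed M lborel (\<lambda>\<omega>. \<Sum>i\<in>P. c i * \<xi> i \<omega>)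
      (normal_density (\<Sum>i\<in>P. 0) (sqrt (\<Sum>i\<in>P. (\<bar>c i\<bar> * \<sigma>)\<^sup>2)))"
    using assms sigma_pos finite_subset[OF assms(1) finite_I] by (intro sum_indep_normal) auto
  from distributed_AE2[OF this, of "\<lambda>x. x \<noteq> 0"] show ?thesis
    using AE_lborel_singleton[of "0::real"] by (auto elim!: AE_mp)
qed

lemma AE_avg_neq:
  assumes "P \<subseteq> I" "Q \<subseteq> I" "P \<noteq> {}" "Q \<noteq> {}" "P \<inter> Q = {}"
  shows "AE \<omega> in M. avg (\<lambda>i. \<xi> i \<omega>) P \<noteq> avg (\<lambda>i. \<xi> i \<omega>) Q"
proof -
  have finite: "finite P" "finite Q" using assms finite_I by (auto intro: finite_subset)
  define c where "c i = (if i \<in> P then 1 / real (card P) else - 1 / real (card Q))" for i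
  have "(\<Sum>i\<in>P \<union> Q. c i * \<xi> i \<omega>) = avg (\<lambda>i. \<xi> i \<omega>) P - avg (\<lambda>i. \<xi> i \<omega>) Q" for \<omega>
  proof -
    have "(\<Sum>i\<in>P. c i * \<xi> i \<omega>) = avg (\<lambda>i. \<xi> i \<omega>) P"
      by (simp add: c_def avg_def sum_divide_distrib)
    moreover have "(\<Sum>i\<in>Q. c i * \<xi> i \<omega>) = (\<Sum>i\<in>Q. - (\<xi> i \<omega> / real (card Q)))"
      using assms(5) by (intro sum.cong) (auto simp: c_def)
    ultimately show ?thesis using finite assms(5)
      by (simp add: sum.union_disjoint sum_negf avg_def sum_divide_distrib)
  qed
  moreover have "AE \<omega> in M. (\<Sum>i\<in>P \<union> Q. c i * \<xi> i \<omega>) \<noteq> 0"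
    using assms finite by (intro AE_sum_mult_neq_0) (auto simp: c_def)
  ultimately show ?thesis by simp
qed

lemma AE_distinct_averages: "AE \<omega> in M. distinct_averages (\<lambda>i. \<xi> i \<omega>) I"
proof -
  let ?pairs = "{(P, Q). P \<subseteq> I \<and> Q \<subseteq> I \<and> P \<noteq> {} \<and> Q \<noteq> {} \<and> P \<inter> Q = {}}"
  have "finite ?pairs"
    by (rule finite_subset[of _ "Pow I \<times> Pow I"]) (use finite_I in auto)
  then have "AE \<omega> in M. \<forall>(P, Q)\<in>?pairs. avg (\<lambda>i. \<xi> i \<omega>) P \<noteq> avg (\<lambda>i. \<xi> i \<omega>) Q"
    using AE_avg_neq by (intro AE_finite_allI) auto
  then show ?thesis by (rule AE_mp) (auto simp: distinct_averages_def)
qed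

lemma measurable_monotone_gain_noise:
  assumes "set xs \<subseteq> I"
  shows "(\<lambda>\<omega>. monotone_gain (\<lambda>i. \<xi> i \<omega>) xs) \<in> borel_measurable M"
  using assms measurable_noise
  by (intro measurable_depends_only_on[OF borel_measurable_monotone_gain
        depends_only_on_monotone_gain]) auto

lemma nn_integral_exp_monotone_gain_exchange:
  assumes "distinct xs" "set xs \<subseteq> I" "distinct ys" "set ys \<subseteq> I" "length xs = length ys"
  shows "(\<integral>\<^sup>+\<omega>. exp (s * monotone_gain (\<lambda>i. \<xi> i \<omega>) xs) \<partial>M)
       = (\<integral>\<^sup>+\<omega>. exp (s * monotone_gain (\<lambda>i. \<xi> i \<omega>) ys) \<partial>M)"
proof -
  define F where "F = (\<lambda>g. ennreal (exp (s * monotone_gain g [0..<length ys])))"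
  have by_position: "F (\<lambda>k. \<xi> (zs ! k) \<omega>) = exp (s * monotone_gain (\<lambda>i. \<xi> i \<omega>) zs)"
    if "distinct zs" "length zs = length ys" for zs \<omega>
    unfolding F_def that(2)[symmetric] by (simp only: monotone_gain_nth[OF that(1), of "\<lambda>i. \<xi> i \<omega>"])
  have "F \<in> borel_measurable borel"
    unfolding F_def by measurable
  moreover have "depends_only_on F {..<length ys}"
    using depends_only_on_compose[OF depends_only_on_monotone_gain, of "\<lambda>v. ennreal (exp (s * v))"]
    unfolding F_def lessThan_atLeast0 by (metis atLeastLessThan_upt)
  ultimately have "(\<integral>\<^sup>+\<omega>. F (\<lambda>k. \<xi> (xs ! k) \<omega>) \<partial>M) = (\<integral>\<^sup>+\<omega>. F (\<lambda>k. \<xi> (ys ! k) \<omega>) \<partial>M)"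
    using assms
    by (intro nn_integral_iid_exchangeable[OF indep distr_noise]) (auto intro!: inj_on_nth)
  then show ?thesis using assms by (simp add: by_position)
qed

lemma nn_integral_block_weight:
  assumes P: "P \<subseteq> I" "P \<noteq> {}" and s: "2 * s * \<sigma>\<^sup>2 < 1"
  shows "(\<integral>\<^sup>+\<omega>. block_weight s (\<lambda>i. \<xi> i \<omega>) P \<partial>M)
    = ennreal (1 / sqrt (1 - 2 * s * \<sigma>\<^sup>2) * fact (card P - 1))"
proof -
  have [measurable]: "\<xi> i \<in> borel_measurable M" if "i \<in> P" for i
    using that P(1) by (intro measurable_noise) auto
  have "(\<integral>\<^sup>+\<omega>. block_weight s (\<lambda>i. \<xi> i \<omega>) P \<partial>M)
      = ennreal (fact (card P - 1)) * (\<integral>\<^sup>+\<omega>. exp (s * block_gain (\<lambda>i. \<xi> i \<omega>) P) \<partial>M)"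
    unfolding block_weight_def block_gain_def
    by (subst nn_integral_cmult[symmetric]) (auto simp: ennreal_mult)
  then show ?thesis
    using nn_integral_exp_block_gain[OF P s] s by (simp add: mult.commute flip: ennreal_mult)
qed

lemma nn_integral_prod_block_weight:
  assumes X: "partition_on S X" and S: "S \<subseteq> I" and s: "2 * s * \<sigma>\<^sup>2 < 1"
  shows "(\<integral>\<^sup>+\<omega>. (\<Prod>P\<in>X. ennreal (block_weight s (\<lambda>i. \<xi> i \<omega>) P)) \<partial>M)
    = ennreal (\<Prod>P\<in>X. 1 / sqrt (1 - 2 * s * \<sigma>\<^sup>2) * fact (card P - 1))"
proof -
  have "(\<integral>\<^sup>+\<omega>. (\<Prod>P\<in>X. ennreal (block_weight s (\<lambda>i. \<xi> i \<omega>) P)) \<partial>M)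
      = (\<Prod>P\<in>X. \<integral>\<^sup>+\<omega>. block_weight s (\<lambda>i. \<xi> i \<omega>) P \<partial>M)"
  proof (rule nn_integral_prod_partition[OF indep S _ X])
    show "finite S" using S finite_I by (rule finite_subset)
    show "(\<lambda>g. ennreal (block_weight s g P)) \<in> borel_measurable borel" for P
      unfolding block_weight_def block_gain_def by measurable
    show "depends_only_on (\<lambda>g. ennreal (block_weight s g P)) P" for P
      by (auto simp: depends_only_on_def block_weight_def block_gain_def cong: sum.cong)
  qed
  also have "\<dots> = (\<Prod>P\<in>X. ennreal (1 / sqrt (1 - 2 * s * \<sigma>\<^sup>2) * fact (card P - 1)))"
    using partition_on_block[OF X] S s by (intro prod.cong refl nn_integral_block_weight) auto
  also have "\<dots> = ennreal (\<Prod>P\<in>X. 1 / sqrt (1 - 2 * s * \<sigma>\<^sup>2) * fact (card P - 1))"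
    using s by (intro prod_ennreal) simp
  finally show ?thesis .
qed

lemma nn_integral_sum_permutations_exp_monotone_gain_le:
  assumes S: "S \<subseteq> I" and s: "0 \<le> s" "2 * s * \<sigma>\<^sup>2 < 1"
  shows "(\<integral>\<^sup>+\<omega>. (\<Sum>xs\<in>permutations_of_set S. exp (s * monotone_gain (\<lambda>i. \<xi> i \<omega>) xs)) \<partial>M)
    \<le> ennreal (pochhammer (1 / sqrt (1 - 2 * s * \<sigma>\<^sup>2)) (card S))"
proof -
  let ?w = "\<lambda>P :: 'b set. 1 / sqrt (1 - 2 * s * \<sigma>\<^sup>2) * fact (card P - 1)"
  have finite: "finite S" using S finite_I by (rule finite_subset)
  have "(\<integral>\<^sup>+\<omega>. (\<Sum>xs\<in>permutations_of_set S. exp (s * monotone_gain (\<lambda>i. \<xi> i \<omega>) xs)) \<partial>M)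
      \<le> (\<integral>\<^sup>+\<omega>. (\<Sum>X | partition_on S X. \<Prod>P\<in>X. block_weight s (\<lambda>i. \<xi> i \<omega>) P) \<partial>M)"
    using AE_distinct_averages
    by (intro nn_integral_mono_AE, elim AE_mp) (intro AE_I2 impI ennreal_leI
        sum_permutations_exp_monotone_gain_le finite s(1), rule distinct_averages_subset[OF _ S])
  also have "\<dots> = (\<integral>\<^sup>+\<omega>. (\<Sum>X | partition_on S X. \<Prod>P\<in>X. ennreal (block_weight s (\<lambda>i. \<xi> i \<omega>) P)) \<partial>M)"
    by (simp add: prod_ennreal sum_ennreal prod_nonneg)
  also have "\<dots> = (\<Sum>X | partition_on S X. \<integral>\<^sup>+\<omega>. (\<Prod>P\<in>X. ennreal (block_weight s (\<lambda>i. \<xi> i \<omega>) P)) \<partial>M)"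
  proof (rule nn_integral_sum)
    fix X assume X: "X \<in> {X. partition_on S X}"
    have [measurable]: "\<xi> i \<in> borel_measurable M" if "i \<in> P" "P \<in> X" for i P
      using X that S by (intro measurable_noise) (auto dest: partition_onD1)
    show "(\<lambda>\<omega>. \<Prod>P\<in>X. ennreal (block_weight s (\<lambda>i. \<xi> i \<omega>) P)) \<in> borel_measurable M"
      unfolding block_weight_def block_gain_def by measurable
  qed
  also have "\<dots> = (\<Sum>X | partition_on S X. ennreal (\<Prod>P\<in>X. ?w P))"
    by (intro sum.cong refl nn_integral_prod_block_weight[OF _ S s(2)]) simp
  also have "\<dots> = ennreal (\<Sum>X | partition_on S X. \<Prod>P\<in>X. ?w P)"
    using s(2) by (intro sum_ennreal prod_nonneg) simp
  also have "\<dots> = ennreal (pochhammer (1 / sqrt (1 - 2 * s * \<sigma>\<^sup>2)) (card S))"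
    by (subst sum_partitions_prod_fact[OF finite]) (rule refl)
  finally show ?thesis .
qed

lemma nn_integral_exp_monotone_gain_le:
  assumes xs: "distinct xs" "set xs \<subseteq> I" and s: "0 \<le> s" "2 * s * \<sigma>\<^sup>2 < 1"
  shows "(\<integral>\<^sup>+\<omega>. exp (s * monotone_gain (\<lambda>i. \<xi> i \<omega>) xs) \<partial>M)
    \<le> ennreal (pochhammer (1 / sqrt (1 - 2 * s * \<sigma>\<^sup>2)) (length xs) / fact (length xs))"
proof -
  let ?E = "\<lambda>ys. \<integral>\<^sup>+\<omega>. exp (s * monotone_gain (\<lambda>i. \<xi> i \<omega>) ys) \<partial>M"
  let ?c = "1 / sqrt (1 - 2 * s * \<sigma>\<^sup>2)"
  have ys: "distinct ys" "set ys \<subseteq> I" "length xs = length ys"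
    if "ys \<in> permutations_of_set (set xs)" for ys
    using that xs distinct_card[of xs] distinct_card[of ys] by (auto simp: permutations_of_set_def)
  have "ennreal (fact (length xs)) * ?E xs = (\<Sum>ys\<in>permutations_of_set (set xs). ?E xs)"
    using xs(1) by (simp add: distinct_card ennreal_of_nat_eq_real_of_nat)
  also have "\<dots> = (\<Sum>ys\<in>permutations_of_set (set xs). ?E ys)"
    using xs ys by (intro sum.cong refl nn_integral_exp_monotone_gain_exchange)
  also have "\<dots> = (\<integral>\<^sup>+\<omega>. (\<Sum>ys\<in>permutations_of_set (set xs).
      exp (s * monotone_gain (\<lambda>i. \<xi> i \<omega>) ys)) \<partial>M)"
  proof (subst nn_integral_sum[symmetric])
    fix ys assume "ys \<in> permutations_of_set (set xs)"
    with ys(2) have [measurable]: "(\<lambda>\<omega>. monotone_gain (\<lambda>i. \<xi> i \<omega>) ys) \<in> borel_measurable M"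
      by (intro measurable_monotone_gain_noise)
    show "(\<lambda>\<omega>. ennreal (exp (s * monotone_gain (\<lambda>i. \<xi> i \<omega>) ys))) \<in> borel_measurable M"
      by measurable
  qed (simp add: sum_ennreal)
  also have "\<dots> \<le> ennreal (pochhammer ?c (length xs))"
    using nn_integral_sum_permutations_exp_monotone_gain_le[OF xs(2) s] xs(1)
    by (simp add: distinct_card)
  also have "\<dots> = ennreal (fact (length xs)) *
      ennreal (pochhammer ?c (length xs) / fact (length xs))"
    using s(2)
    by (subst ennreal_mult[symmetric]) (auto intro!: pochhammer_nonneg divide_nonneg_nonneg)
  finally show ?thesis by (simp add: ennreal_mult_le_mult_iff)
qed

lemma nn_integral_exp_quarter_monotone_gain_le:
  assumes "distinct xs" "set xs \<subseteq> I"
  shows "(\<integral>\<^sup>+\<omega>. exp (1 / (4 * \<sigma>\<^sup>2) * monotone_gain (\<lambda>i. \<xi> i \<omega>) xs) \<partial>M)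
    \<le> ennreal (real (length xs) + 1)"
proof -
  have half: "2 * (1 / (4 * \<sigma>\<^sup>2)) * \<sigma>\<^sup>2 = 1 / 2" and sqrt2: "1 / sqrt (1 - 1 / 2) = sqrt 2"
    using sigma_pos by (simp_all add: real_sqrt_divide)
  have "pochhammer (sqrt 2) (length xs) \<le> pochhammer 2 (length xs)"
    by (intro pochhammer_mono) (simp_all add: sqrt2_less_2 less_imp_le)
  also have "\<dots> = fact (Suc (length xs))"
    using pochhammer_rec[of "1::real" "length xs"]
      pochhammer_fact[of "Suc (length xs)", where 'a = real] by simp
  finally have "pochhammer (sqrt 2) (length xs) / fact (length xs) \<le> real (length xs) + 1"
    by (simp add: divide_le_eq add.commute)
  moreover have "(\<integral>\<^sup>+\<omega>. exp (1 / (4 * \<sigma>\<^sup>2) * monotone_gain (\<lambda>i. \<xi> i \<omega>) xs) \<partial>M)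
      \<le> ennreal (pochhammer (sqrt 2) (length xs) / fact (length xs))"
    using nn_integral_exp_monotone_gain_le[OF assms, of "1 / (4 * \<sigma>\<^sup>2)"]
    unfolding half sqrt2 by simp
  ultimately show ?thesis by (meson ennreal_leI order_trans)
qed

end

section \<open>Convexity along a design\<close>

definition convex_along :: "('i::linorder \<Rightarrow> real) \<Rightarrow> 'i set \<Rightarrow> ('i \<Rightarrow> real) \<Rightarrow> bool" where
  "convex_along x T w \<longleftrightarrow> (\<forall>i\<in>T. \<forall>k\<in>T. \<forall>l\<in>T. i < k \<and> k < l \<longrightarrow>
     (w k - w i) * (x l - x k) \<le> (w l - w k) * (x k - x i))"

definition affine_along :: "('i \<Rightarrow> real) \<Rightarrow> 'i set \<Rightarrow> ('i \<Rightarrow> real) \<Rightarrow> bool" where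
  "affine_along x T u \<longleftrightarrow> (\<exists>a. \<forall>i\<in>T. \<forall>l\<in>T. u i = a * (x i - x l) + u l)"

lemma convex_alongD:
  assumes "convex_along x T w" "i \<in> T" "k \<in> T" "l \<in> T" "i < k" "k < l"
  shows "(w k - w i) * (x l - x k) \<le> (w l - w k) * (x k - x i)"
  using assms by (simp add: convex_along_def)

lemma convex_along_subset: "convex_along x S w \<Longrightarrow> T \<subseteq> S \<Longrightarrow> convex_along x T w"
  unfolding convex_along_def by (meson subsetD)

lemma convex_along_diff_affine:
  assumes "convex_along x T v" "affine_along x T u"
  shows "convex_along x T (\<lambda>i. v i - u i)"
  unfolding convex_along_def
proof (intro ballI impI, elim conjE)
  fix i k l assume ikl: "i \<in> T" "k \<in> T" "l \<in> T" "i < k" "k < l"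
  obtain a where a: "\<And>i l. i \<in> T \<Longrightarrow> l \<in> T \<Longrightarrow> u i = a * (x i - x l) + u l"
    using assms(2) unfolding affine_along_def by blast
  have slopes: "v k - u k - (v i - u i) = v k - v i - a * (x k - x i)"
    "v l - u l - (v k - u k) = v l - v k - a * (x l - x k)"
    using a[OF ikl(2,1)] a[OF ikl(3,2)] by simp_all
  show "(v k - u k - (v i - u i)) * (x l - x k) \<le> (v l - u l - (v k - u k)) * (x k - x i)"
    using convex_alongD[OF assms(1) ikl] unfolding slopes by (simp add: algebra_simps)
qed

lemma convex_along_antimono_before_min:
  assumes x: "strict_mono_on T x" and convex: "convex_along x T w"
    and a: "a \<in> T" "\<And>i. i \<in> T \<Longrightarrow> w a \<le> w i"
  shows "antimono_on {i \<in> T. i < a} w"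
proof (rule monotone_onI)
  fix i k assume ik: "i \<in> {i \<in> T. i < a}" "k \<in> {i \<in> T. i < a}" "i \<le> k"
  show "w k \<le> w i"
  proof (cases "i = k")
    case False
    then have "x i < x k" "x k < x a"
      using ik a(1) strict_mono_onD[OF x] by auto
    have "(w k - w i) * (x a - x k) \<le> (w a - w k) * (x k - x i)"
      using ik a(1) False by (intro convex_alongD[OF convex]) auto
    also have "\<dots> \<le> 0"
      using ik a(2)[of k] \<open>x i < x k\<close> by (intro mult_nonpos_nonneg) auto
    finally show ?thesis using \<open>x k < x a\<close> by (simp add: mult_le_0_iff)
  qed simp
qed

lemma convex_along_mono_after_min:
  assumes x: "strict_mono_on T x" and convex: "convex_along x T w"
    and a: "a \<in> T" "\<And>i. i \<in> T \<Longrightarrow> w a \<le> w i"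
  shows "mono_on {i \<in> T. a \<le> i} w"
proof (rule mono_onI)
  fix i k assume ik: "i \<in> {i \<in> T. a \<le> i}" "k \<in> {i \<in> T. a \<le> i}" "i \<le> k"
  show "w i \<le> w k"
  proof (cases "i = k \<or> i = a")
    case False
    then have "x a < x i" "x i < x k"
      using ik a(1) strict_mono_onD[OF x] by auto
    have "0 \<le> (w i - w a) * (x k - x i)"
      using ik a(2)[of i] \<open>x i < x k\<close> by simp
    also have "\<dots> \<le> (w k - w i) * (x i - x a)"
      using ik a(1) False by (intro convex_alongD[OF convex]) auto
    finally show ?thesis using \<open>x a < x i\<close> by (simp add: zero_le_mult_iff)
  qed (use ik a(2) in auto)
qed

definition left_arm :: "'i::linorder set \<Rightarrow> 'i \<Rightarrow> 'i list" where
  "left_arm T a = rev (sorted_list_of_set {i \<in> T. i < a})"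

definition right_arm :: "'i::linorder set \<Rightarrow> 'i \<Rightarrow> 'i list" where
  "right_arm T a = sorted_list_of_set {i \<in> T. a \<le> i}"

lemma distinct_arms: "distinct (left_arm T a)" "distinct (right_arm T a)"
  by (simp_all add: left_arm_def right_arm_def)

lemma set_arms:
  assumes "finite T"
  shows "set (left_arm T a) = {i \<in> T. i < a}" "set (right_arm T a) = {i \<in> T. a \<le> i}"
  using assms by (simp_all add: left_arm_def right_arm_def)

lemma length_arms:
  assumes "finite T" "a \<in> T"
  shows "length (left_arm T a) < card T" "length (right_arm T a) \<le> card T"
proof -
  have "card (set (left_arm T a)) < card T"
    using assms by (intro psubset_card_mono) (auto simp: set_arms)
  then show "length (left_arm T a) < card T"
    by (simp add: distinct_card distinct_arms)
  have "card (set (right_arm T a)) \<le> card T"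
    using assms by (intro card_mono) (auto simp: set_arms)
  then show "length (right_arm T a) \<le> card T"
    by (simp add: distinct_card distinct_arms)
qed

lemma sorted_map_left_arm:
  assumes "antimono_on {i \<in> T. i < a} w" "finite T"
  shows "sorted (map w (left_arm T a))"
  unfolding left_arm_def sorted_map sorted_wrt_rev
  by (rule sorted_wrt_mono_rel[OF _ sorted_sorted_list_of_set])
    (use assms in \<open>auto dest: monotone_onD\<close>)

lemma sorted_map_right_arm:
  assumes "mono_on {i \<in> T. a \<le> i} w" "finite T"
  shows "sorted (map w (right_arm T a))"
  using assms by (simp add: right_arm_def sorted_map_mono)

lemma sum_eq_sum_list_arms:
  assumes "finite T"
  shows "sum f T = (\<Sum>i\<leftarrow>left_arm T a. f i) + (\<Sum>i\<leftarrow>right_arm T a. f i)"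
proof -
  have "T = set (left_arm T a) \<union> set (right_arm T a)"
    "set (left_arm T a) \<inter> set (right_arm T a) = {}"
    using assms by (auto simp: set_arms)
  then have "sum f T = sum f (set (left_arm T a)) + sum f (set (right_arm T a))"
    by (metis List.finite_set sum.union_disjoint)
  then show ?thesis by (simp add: sum_list_distinct_conv_sum_set distinct_arms)
qed

definition convex_gain_bound :: "real \<Rightarrow> ('i::linorder \<Rightarrow> real) \<Rightarrow> 'i set \<Rightarrow> real" where
  "convex_gain_bound s g T =
    (\<Sum>a\<in>T. exp (s * monotone_gain g (left_arm T a)) * exp (s * monotone_gain g (right_arm T a)))"

lemma convex_gain_bound_nonneg [simp]: "convex_gain_bound s g T \<ge> 0"
  unfolding convex_gain_bound_def by (intro sum_nonneg) simp

lemma exp_sum_gain_le_convex_gain_bound: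
  assumes T: "finite T" "T \<noteq> {}" and convex: "strict_mono_on T x" "convex_along x T w"
    and s: "s \<ge> 0"
  shows "exp (s * sum (gain g w) T) \<le> convex_gain_bound s g T"
proof -
  obtain a where a: "a \<in> T" "\<And>i. i \<in> T \<Longrightarrow> w a \<le> w i"
    using ex_is_arg_min_if_finite[OF T, of w] by (auto simp: is_arg_min_linorder)
  have "sum (gain g w) T \<le> monotone_gain g (left_arm T a) + monotone_gain g (right_arm T a)"
    unfolding sum_eq_sum_list_arms[OF T(1), of _ a]
    by (intro add_mono sum_list_gain_le_monotone_gain sorted_map_left_arm sorted_map_right_arm T(1)
        convex_along_antimono_before_min[OF convex a] convex_along_mono_after_min[OF convex a])
  from mult_left_mono[OF this s]
  have "exp (s * sum (gain g w) T)
      \<le> exp (s * monotone_gain g (left_arm T a)) * exp (s * monotone_gain g (right_arm T a))"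
    by (simp add: distrib_left flip: exp_add)
  also have "\<dots> \<le> convex_gain_bound s g T"
    unfolding convex_gain_bound_def using a(1) T(1)
    by (intro member_le_sum[where f = "\<lambda>a. exp (s * monotone_gain g (left_arm T a)) *
          exp (s * monotone_gain g (right_arm T a))"]) auto
  finally show ?thesis .
qed

lemma exp_sum_gain_le_prod_convex_gain_bound:
  assumes "finite S" and x: "strict_mono_on S x" and v: "convex_along x S v"
    and X: "partition_on S X" and u: "\<And>P. P \<in> X \<Longrightarrow> affine_along x P u" and s: "s \<ge> 0"
  shows "exp (s * (\<Sum>i\<in>S. gain g (\<lambda>i. v i - u i) i)) \<le> (\<Prod>P\<in>X. convex_gain_bound s g P)"
proof -
  let ?gain = "gain g (\<lambda>i. v i - u i)"
  have blocks: "P \<subseteq> S" "P \<noteq> {}" "finite P" if "P \<in> X" for P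
    using partition_on_block[OF X that] finite_subset[OF _ \<open>finite S\<close>] by auto
  have "sum ?gain S = (\<Sum>P\<in>X. sum ?gain P)"
    using sum.Union_disjoint[of X ?gain] blocks partition_onD1[OF X] partition_onD2[OF X]
    by (auto simp: disjoint_def)
  then have "exp (s * sum ?gain S) = (\<Prod>P\<in>X. exp (s * sum ?gain P))"
    using finite_elements[OF \<open>finite S\<close> X] by (simp add: exp_sum sum_distrib_left)
  also have "\<dots> \<le> (\<Prod>P\<in>X. convex_gain_bound s g P)"
  proof (intro prod_mono conjI)
    fix P assume P: "P \<in> X"
    have "convex_along x P (\<lambda>i. v i - u i)"
      using v u P blocks by (intro convex_along_diff_affine) (auto intro: convex_along_subset)
    moreover have "strict_mono_on P x"
      using x blocks(1)[OF P] by (rule monotone_on_subset)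
    ultimately show "exp (s * sum ?gain P) \<le> convex_gain_bound s g P"
      using blocks[OF P] s by (intro exp_sum_gain_le_convex_gain_bound)
  qed simp
  finally show ?thesis .
qed

lemma depends_only_on_convex_gain_bound:
  assumes "finite T"
  shows "depends_only_on (\<lambda>g. convex_gain_bound s g T) T"
  unfolding depends_only_on_def
proof (intro allI impI)
  fix g h :: "'a \<Rightarrow> real" assume "\<forall>i\<in>T. g i = h i"
  then have "monotone_gain g (left_arm T a) = monotone_gain h (left_arm T a)"
    "monotone_gain g (right_arm T a) = monotone_gain h (right_arm T a)" for a
    using assms by (auto intro!: monotone_gain_cong simp: set_arms)
  then show "convex_gain_bound s g T = convex_gain_bound s h T"
    by (simp add: convex_gain_bound_def)
qed

lemma borel_measurable_convex_gain_bound [measurable]: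
  "(\<lambda>g. convex_gain_bound s g T) \<in> borel_measurable borel"
  unfolding convex_gain_bound_def by measurable

definition slope :: "(nat \<Rightarrow> real) \<Rightarrow> (nat \<Rightarrow> real) \<Rightarrow> nat \<Rightarrow> real" where
  "slope x u j = (u (Suc j) - u j) / (x (Suc j) - x j)"

lemma convex_seqs_slope_mono:
  assumes u: "u \<in> convex_seqs n x" and "1 \<le> j" "j \<le> k" "k < n"
  shows "slope x u j \<le> slope x u k"
  using assms(3,4)
proof (induction k rule: dec_induct)
  case (step k)
  have "Suc k \<in> {2..n - 1}" using assms(2) step by auto
  then have "slope x u k \<le> slope x u (Suc k)"
    using u unfolding convex_seqs_def slope_def by fastforce
  with step show ?case by simp
qed simp

lemma convex_seqs_supporting_line:
  assumes u: "u \<in> convex_seqs n x" and x: "strict_mono_on {1..n} x"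
    and k: "1 \<le> k" "k < n" and m: "m \<in> {1..n}"
  shows "u k + slope x u k * (x m - x k) \<le> u m"
proof -
  have step: "x (Suc j) - x j > 0" if "1 \<le> j" "j < n" for j
    using strict_mono_onD[OF x, of j "Suc j"] that by simp
  have increment: "u (Suc j) - u j = slope x u j * (x (Suc j) - x j)" if "1 \<le> j" "j < n" for j
    using step[OF that] by (simp add: slope_def)
  show ?thesis
  proof (cases "k \<le> m")
    case True
    have "slope x u k * (x m - x k) = (\<Sum>j=k..<m. slope x u k * (x (Suc j) - x j))"
      using True by (simp only: sum_Suc_diff' sum_distrib_left[symmetric])
    also have "\<dots> \<le> (\<Sum>j=k..<m. u (Suc j) - u j)"
    proof (rule sum_mono)
      fix j assume "j \<in> {k..<m}"
      then show "slope x u k * (x (Suc j) - x j) \<le> u (Suc j) - u j"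
        using convex_seqs_slope_mono[OF u, of k j] step[of j] k m by (simp add: increment)
    qed
    also have "\<dots> = u m - u k" using True by (rule sum_Suc_diff')
    finally show ?thesis by simp
  next
    case False
    then have "u k - u m = (\<Sum>j=m..<k. u (Suc j) - u j)"
      by (intro sum_Suc_diff'[symmetric]) simp
    also have "\<dots> \<le> (\<Sum>j=m..<k. slope x u k * (x (Suc j) - x j))"
    proof (rule sum_mono)
      fix j assume "j \<in> {m..<k}"
      then show "u (Suc j) - u j \<le> slope x u k * (x (Suc j) - x j)"
        using convex_seqs_slope_mono[OF u, of j k] step[of j] k m by (simp add: increment)
    qed
    also have "\<dots> = slope x u k * (x k - x m)"
      using False by (simp only: sum_Suc_diff' sum_distrib_left[symmetric] not_le less_imp_le)
    finally show ?thesis by (simp add: right_diff_distrib)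
  qed
qed

lemma convex_seqs_convex_along:
  assumes u: "u \<in> convex_seqs n x" and x: "strict_mono_on {1..n} x"
  shows "convex_along x {1..n} u"
  unfolding convex_along_def
proof (intro ballI impI, elim conjE)
  fix i k l assume ikl: "i \<in> {1..n}" "k \<in> {1..n}" "l \<in> {1..n}" "i < k" "k < l"
  have "x i < x k" "x k < x l"
    using strict_mono_onD[OF x] ikl by blast+
  have line: "u k + slope x u k * (x m - x k) \<le> u m" if "m \<in> {1..n}" for m
    using ikl that by (intro convex_seqs_supporting_line[OF u x]) auto
  have "(u k - u i) * (x l - x k) \<le> slope x u k * (x k - x i) * (x l - x k)"
    using line[OF ikl(1)] \<open>x k < x l\<close> by (intro mult_right_mono) (auto simp: right_diff_distrib)
  also have "\<dots> = slope x u k * (x l - x k) * (x k - x i)" by simp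
  also have "\<dots> \<le> (u l - u k) * (x k - x i)"
    using line[OF ikl(3)] \<open>x i < x k\<close> by (intro mult_right_mono) auto
  finally show "(u k - u i) * (x l - x k) \<le> (u l - u k) * (x k - x i)" .
qed

lemma
  assumes "n \<ge> 1"
  shows num_pieces_le: "num_pieces n x u \<le> n"
    and num_pieces_pos: "num_pieces n x u \<ge> 1"
    and piecewise_affine_num_pieces: "piecewise_affine n x u (num_pieces n x u)"
proof -
  have "partition_on {1..n} ((\<lambda>i. {i}) ` {1..n})" by (rule partition_on_singletons)
  then have singletons: "n \<ge> 1 \<and> piecewise_affine n x u n"
    using assms unfolding piecewise_affine_def
    by (intro conjI exI[of _ "\<lambda>_. 0"] exI[of _ "\<lambda>i. {i}"]) (auto simp: inj_on_def)
  show "num_pieces n x u \<le> n"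
    unfolding num_pieces_def using singletons by (rule Least_le)
  have "num_pieces n x u \<ge> 1 \<and> piecewise_affine n x u (num_pieces n x u)"
    unfolding num_pieces_def using singletons by (rule LeastI)
  then show "num_pieces n x u \<ge> 1" "piecewise_affine n x u (num_pieces n x u)" by auto
qed

lemma num_pieces_partition:
  assumes "n \<ge> 1"
  obtains X where "partition_on {1..n} X" "card X = num_pieces n x u"
    "\<And>P. P \<in> X \<Longrightarrow> affine_along x P u"
proof -
  define q where "q = num_pieces n x u"
  obtain a T where T: "inj_on T {1..q}" "partition_on {1..n} (T ` {1..q})"
    and affine: "\<forall>j\<in>{1..q}. \<forall>i\<in>T j. \<forall>l\<in>T j. u i = a j * (x i - x l) + u l"
    using piecewise_affine_num_pieces[OF assms, of x u]
    unfolding piecewise_affine_def q_def by blast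
  have "card (T ` {1..q}) = num_pieces n x u"
    using T(1) by (simp add: card_image q_def)
  moreover have "affine_along x P u" if "P \<in> T ` {1..q}" for P
    using that affine unfolding affine_along_def by blast
  ultimately show ?thesis using T(2) that by blast
qed

section \<open>Projections onto closed convex sets\<close>

lemma scaled_norm_sq_nonneg: "scaled_norm_sq n v \<ge> 0"
  by (simp add: scaled_norm_sq_def sum_nonneg)

lemma compact_PiE:
  fixes B :: "'i \<Rightarrow> 'b::topological_space set"
  assumes "\<And>i. i \<in> S \<Longrightarrow> compact (B i)"
  shows "compact (PiE S B)"
proof -
  have "PiE S B = PiE UNIV (\<lambda>i. if i \<in> S then B i else {undefined})"
    by (auto simp: PiE_iff extensional_def split: if_splits)
  moreover have "compactin (product_topology (\<lambda>_ :: 'i. euclidean :: 'b topology) UNIV)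
      (PiE UNIV (\<lambda>i. if i \<in> S then B i else {undefined}))"
    using assms by (subst compactin_PiE) auto
  ultimately show ?thesis by (simp add: euclidean_product_topology)
qed

lemma continuous_on_coordinate: "continuous_on A (\<lambda>v :: 'i \<Rightarrow> 'b::topological_space. v i)"
  by (rule continuous_on_subset[OF continuous_on_product_coordinates]) simp

lemma continuous_on_scaled_norm_sq_diff:
  "continuous_on A (\<lambda>v. scaled_norm_sq n (\<lambda>i. y i - v i))"
  unfolding scaled_norm_sq_def by (intro continuous_intros continuous_on_coordinate)

lemma compact_scaled_norm_sublevel:
  assumes "closed K" and K: "K \<subseteq> {1..n} \<rightarrow>\<^sub>E UNIV" and "n \<ge> 1"
  shows "compact (K \<inter> {v. scaled_norm_sq n (\<lambda>i. y i - v i) \<le> c})" (is "compact ?sublevel")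
proof -
  define r where "r = sqrt (real n * c)"
  let ?box = "PiE {1..n} (\<lambda>i. {y i - r..y i + r})"
  have "v \<in> ?box" if v: "v \<in> ?sublevel" for v
  proof -
    have "v i \<in> {y i - r..y i + r}" if "i \<in> {1..n}" for i
    proof -
      have "(y i - v i)\<^sup>2 \<le> (\<Sum>j=1..n. (y j - v j)\<^sup>2)"
        using that by (intro member_le_sum) auto
      also have "\<dots> = real n * scaled_norm_sq n (\<lambda>i. y i - v i)"
        using assms(3) by (simp add: scaled_norm_sq_def)
      also have "\<dots> \<le> real n * c" using v by (intro mult_left_mono) auto
      finally have "\<bar>y i - v i\<bar> \<le> r" unfolding r_def by (intro real_le_rsqrt) simp
      then show ?thesis by (auto simp: abs_le_iff)
    qed
    then show ?thesis using v K by (auto simp: PiE_iff)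
  qed
  then have "?sublevel \<subseteq> ?box" by blast
  moreover have "closed ?sublevel"
    using assms(1)
    by (intro closed_Int closed_Collect_le continuous_on_scaled_norm_sq_diff continuous_on_const)
  moreover have "compact ?box"
    by (intro compact_PiE compact_Icc)
  ultimately show ?thesis
    using closed_Int_compact[of ?sublevel ?box] by (simp only: Int_absorb2)
qed

lemma least_squares_is_arg_min:
  assumes "closed K" "K \<noteq> {}" "K \<subseteq> {1..n} \<rightarrow>\<^sub>E UNIV" "n \<ge> 1"
  shows "is_arg_min (\<lambda>v. scaled_norm_sq n (\<lambda>i. y i - v i)) (\<lambda>v. v \<in> K) (least_squares n K y)"
proof -
  let ?f = "\<lambda>v. scaled_norm_sq n (\<lambda>i. y i - v i)"
  obtain v0 where v0: "v0 \<in> K" using assms(2) by blast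
  let ?sublevel = "K \<inter> {v. ?f v \<le> ?f v0}"
  have "compact ?sublevel" using assms(1,3,4) by (rule compact_scaled_norm_sublevel)
  then obtain v where v: "v \<in> ?sublevel" and min: "\<And>w. w \<in> ?sublevel \<Longrightarrow> ?f v \<le> ?f w"
    using continuous_attains_inf[OF _ _ continuous_on_scaled_norm_sq_diff, of ?sublevel n y] v0
    by blast
  have "?f v \<le> ?f w" if "w \<in> K" for w
    using v min[of w] that by (cases "?f w \<le> ?f v0") auto
  with v have "is_arg_min ?f (\<lambda>v. v \<in> K) v"
    by (simp add: is_arg_min_linorder)
  then show ?thesis
    unfolding least_squares_def arg_min_def by (rule someI[where P = "is_arg_min ?f (\<lambda>v. v \<in> K)"])
qed

lemma depends_only_on_least_squares: "depends_only_on (least_squares n K) {1..n}"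
  unfolding depends_only_on_def
proof (intro allI impI)
  fix g h :: "nat \<Rightarrow> real" assume "\<forall>i\<in>{1..n}. g i = h i"
  then have "scaled_norm_sq n (\<lambda>i. g i - v i) = scaled_norm_sq n (\<lambda>i. h i - v i)" for v
    by (simp add: scaled_norm_sq_def)
  then show "least_squares n K g = least_squares n K h"
    by (simp add: least_squares_def)
qed

locale least_squares_projection =
  fixes n :: nat and K :: "(nat \<Rightarrow> real) set"
  assumes dim_pos: "n \<ge> 1" and closed: "closed K" and nonempty: "K \<noteq> {}"
    and extensional: "K \<subseteq> {1..n} \<rightarrow>\<^sub>E UNIV"
    and segment: "\<And>u v c. u \<in> K \<Longrightarrow> v \<in> K \<Longrightarrow> 0 \<le> c \<Longrightarrow> c \<le> 1 \<Longrightarrow>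
      (\<lambda>i\<in>{1..n}. v i + c * (u i - v i)) \<in> K"
begin

abbreviation proj :: "(nat \<Rightarrow> real) \<Rightarrow> nat \<Rightarrow> real" where
  "proj \<equiv> least_squares n K"

lemma proj_in: "proj y \<in> K"
  and sum_square_proj_le: "v \<in> K \<Longrightarrow> (\<Sum>i=1..n. (y i - proj y i)\<^sup>2) \<le> (\<Sum>i=1..n. (y i - v i)\<^sup>2)"
  using least_squares_is_arg_min[OF closed nonempty extensional dim_pos, of y] dim_pos
  by (simp_all add: is_arg_min_linorder scaled_norm_sq_def divide_le_cancel)

lemma proj_variational:
  assumes u: "u \<in> K"
  shows "(\<Sum>i=1..n. (y i - proj y i) * (u i - proj y i)) \<le> 0"
proof (rule ccontr)
  define gap where "gap = (\<Sum>i=1..n. (y i - proj y i) * (u i - proj y i))"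
  define dist_sq where "dist_sq = (\<Sum>i=1..n. (u i - proj y i)\<^sup>2)"
  assume "\<not> ?thesis"
  then have "gap > 0" by (simp add: gap_def)
  have "dist_sq \<ge> 0" by (simp add: dist_sq_def sum_nonneg)
  define c where "c = gap / (gap + dist_sq)"
  have "c > 0" "c \<le> 1" "c * dist_sq \<le> gap"
    using \<open>gap > 0\<close> \<open>dist_sq \<ge> 0\<close> by (auto simp: c_def field_simps)
  let ?z = "\<lambda>i\<in>{1..n}. proj y i + c * (u i - proj y i)"
  have "(\<Sum>i=1..n. (y i - proj y i)\<^sup>2) \<le> (\<Sum>i=1..n. (y i - ?z i)\<^sup>2)"
    using \<open>c > 0\<close> \<open>c \<le> 1\<close> by (intro sum_square_proj_le segment u proj_in) auto
  also have "\<dots> = (\<Sum>i=1..n. (y i - proj y i)\<^sup>2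
      - 2 * c * ((y i - proj y i) * (u i - proj y i)) + c\<^sup>2 * (u i - proj y i)\<^sup>2)"
    by (intro sum.cong) (auto simp: power2_eq_square algebra_simps)
  also have "\<dots> = (\<Sum>i=1..n. (y i - proj y i)\<^sup>2) - 2 * c * gap + c\<^sup>2 * dist_sq"
    by (simp add: sum.distrib sum_subtractf gap_def dist_sq_def sum_distrib_left)
  finally have "c * (2 * gap) \<le> c * (c * dist_sq)" by (simp add: power2_eq_square mult_ac)
  with \<open>c > 0\<close> \<open>c * dist_sq \<le> gap\<close> \<open>gap > 0\<close> show False by simp
qed

lemma proj_nonexpansive:
  "(\<Sum>i=1..n. (proj y i - proj y' i)\<^sup>2) \<le> (\<Sum>i=1..n. (y i - y' i)\<^sup>2)"
proof -
  have "(\<Sum>i=1..n. (proj y i - proj y' i)\<^sup>2) - (\<Sum>i=1..n. (y i - y' i)\<^sup>2)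
      \<le> (\<Sum>i=1..n. 2 * ((y i - proj y i) * (proj y' i - proj y i)
          + (y' i - proj y' i) * (proj y i - proj y' i)))"
    unfolding sum_subtractf[symmetric]
  proof (rule sum_mono)
    fix i
    have "0 \<le> ((y i - y' i) - (proj y i - proj y' i))\<^sup>2" by simp
    then show "(proj y i - proj y' i)\<^sup>2 - (y i - y' i)\<^sup>2
      \<le> 2 * ((y i - proj y i) * (proj y' i - proj y i)
          + (y' i - proj y' i) * (proj y i - proj y' i))"
      by (simp add: power2_eq_square algebra_simps)
  qed
  also have "\<dots> \<le> 0"
    using proj_variational[OF proj_in[of y'], of y] proj_variational[OF proj_in[of y], of y']
    by (simp add: sum.distrib flip: sum_distrib_left)
  finally show ?thesis by simp
qed

lemma abs_proj_diff_le:
  assumes "i \<in> {1..n}"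
  shows "\<bar>proj y i - proj y' i\<bar> \<le> sqrt (\<Sum>j=1..n. (y j - y' j)\<^sup>2)"
proof -
  have "(proj y i - proj y' i)\<^sup>2 \<le> (\<Sum>j=1..n. (proj y j - proj y' j)\<^sup>2)"
    using assms by (intro member_le_sum) auto
  also have "\<dots> \<le> (\<Sum>j=1..n. (y j - y' j)\<^sup>2)" by (rule proj_nonexpansive)
  finally show ?thesis by (intro real_le_rsqrt) simp
qed

lemma continuous_on_proj:
  assumes "i \<in> {1..n}"
  shows "continuous_on UNIV (\<lambda>y. proj y i)"
proof -
  have "((\<lambda>y. proj y i) \<longlongrightarrow> proj y0 i) (at y0)" for y0
  proof (rule LIM_zero_cancel, rule Lim_null_comparison)
    show "\<forall>\<^sub>F y in at y0. norm (proj y i - proj y0 i) \<le> sqrt (\<Sum>j=1..n. (y j - y0 j)\<^sup>2)"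
      using abs_proj_diff_le[OF assms] by simp
    have "continuous_on UNIV (\<lambda>y. sqrt (\<Sum>j=1..n. (y j - y0 j)\<^sup>2))"
      by (intro continuous_intros continuous_on_coordinate)
    then have "((\<lambda>y. sqrt (\<Sum>j=1..n. (y j - y0 j)\<^sup>2)) \<longlongrightarrow> sqrt (\<Sum>j=1..n. (y0 j - y0 j)\<^sup>2)) (at y0)"
      unfolding continuous_on_def by blast
    then show "((\<lambda>y. sqrt (\<Sum>j=1..n. (y j - y0 j)\<^sup>2)) \<longlongrightarrow> 0) (at y0)" by simp
  qed
  then show ?thesis by (simp add: continuous_on_def)
qed

lemma borel_measurable_proj:
  assumes "i \<in> {1..n}"
  shows "(\<lambda>y. proj y i) \<in> borel_measurable borel"
  using continuous_on_proj[OF assms] by (rule borel_measurable_continuous_onI)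

lemma sum_square_proj_diff_le:
  assumes u: "u \<in> K"
  shows "(\<Sum>i=1..n. (proj (\<lambda>i. \<mu> i + g i) i - \<mu> i)\<^sup>2)
    \<le> (\<Sum>i=1..n. (u i - \<mu> i)\<^sup>2) + (\<Sum>i=1..n. gain g (\<lambda>i. proj (\<lambda>i. \<mu> i + g i) i - u i) i)"
proof -
  let ?y = "\<lambda>i. \<mu> i + g i"
  have "(\<Sum>i=1..n. (proj ?y i - \<mu> i)\<^sup>2) = (\<Sum>i=1..n. (u i - \<mu> i)\<^sup>2)
    + (\<Sum>i=1..n. gain g (\<lambda>i. proj ?y i - u i) i)
    + 2 * (\<Sum>i=1..n. (?y i - proj ?y i) * (u i - proj ?y i))"
    unfolding sum.distrib[symmetric] sum_distrib_left gain_def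
    by (intro sum.cong) (auto simp: power2_eq_square algebra_simps)
  with proj_variational[OF u, of ?y] show ?thesis by simp
qed

end

lemma closed_convex_seqs: "closed (convex_seqs n x)"
proof -
  have "convex_seqs n x = (\<Inter>i\<in>- {1..n}. {u. u i = undefined}) \<inter>
     (\<Inter>i\<in>{2..n - 1}. {u. (u i - u (i - 1)) * inverse (x i - x (i - 1))
        \<le> (u (i + 1) - u i) * inverse (x (i + 1) - x i)})"
    by (auto simp: convex_seqs_def PiE_def extensional_def divide_inverse)
  also have "closed \<dots>"
    by (intro closed_Int closed_INT ballI closed_Collect_le closed_Collect_eq continuous_intros
        continuous_on_coordinate)
  finally show ?thesis .
qed

lemma convex_seqs_nonempty: "convex_seqs n x \<noteq> {}"
proof -
  have "(\<lambda>i\<in>{1..n}. 0) \<in> convex_seqs n x" by (auto simp: convex_seqs_def)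
  then show ?thesis by blast
qed

lemma convex_seqs_segment:
  assumes "u \<in> convex_seqs n x" "v \<in> convex_seqs n x" "0 \<le> c" "c \<le> 1"
  shows "(\<lambda>i\<in>{1..n}. v i + c * (u i - v i)) \<in> convex_seqs n x"
proof -
  define z where "z = (\<lambda>i\<in>{1..n}. v i + c * (u i - v i))"
  have combination: "(z j - z k) / h = (1 - c) * ((v j - v k) / h) + c * ((u j - u k) / h)"
    if "j \<in> {1..n}" "k \<in> {1..n}" for j k and h :: real
    using that by (simp add: z_def divide_inverse algebra_simps)
  have "(z i - z (i - 1)) / (x i - x (i - 1)) \<le> (z (i + 1) - z i) / (x (i + 1) - x i)"
    if i: "i \<in> {2..n - 1}" for i
  proof -
    have range: "i - 1 \<in> {1..n}" "i \<in> {1..n}" "i + 1 \<in> {1..n}" using i by auto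
    show ?thesis
      unfolding combination[OF range(2,1)] combination[OF range(3,2)]
      using assms i by (intro add_mono mult_left_mono) (auto simp: convex_seqs_def)
  qed
  then show ?thesis by (simp add: convex_seqs_def z_def)
qed

lemma least_squares_projection_convex_seqs:
  assumes "n \<ge> 1"
  shows "least_squares_projection n (convex_seqs n x)"
proof -
  have "convex_seqs n x \<subseteq> {1..n} \<rightarrow>\<^sub>E UNIV" by (auto simp: convex_seqs_def)
  with assms show ?thesis
    by (intro least_squares_projection.intro closed_convex_seqs convex_seqs_nonempty
        convex_seqs_segment)
qed

section \<open>The oracle inequality\<close>

lemma prod_le_mean_power:
  fixes c :: "'j \<Rightarrow> real"
  assumes "finite J" "J \<noteq> {}" and nonneg: "\<And>j. j \<in> J \<Longrightarrow> c j \<ge> 0"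
  shows "(\<Prod>j\<in>J. c j) \<le> ((\<Sum>j\<in>J. c j) / real (card J)) ^ card J"
proof -
  have "real (card J) > 0" using assms(1,2) by (simp add: card_gt_0_iff)
  then have "(\<Prod>j\<in>J. c j) = ((\<Prod>j\<in>J. c j) powr (1 / real (card J))) ^ card J"
    using nonneg by (simp add: powr_powr prod_nonneg flip: powr_realpow')
  also have "\<dots> \<le> (\<Sum>j\<in>J. c j / real (card J)) ^ card J"
    using arith_geom_mean[OF assms(1,2) nonneg] by (intro power_mono) auto
  finally show ?thesis by (simp add: sum_divide_distrib)
qed

lemma two_power_mult_power_le_exp_ln:
  fixes r :: real
  assumes "r > 0" "q > 0"
  shows "2 ^ q * (r ^ q) ^ 4 \<le> 2 * exp (- 4) * exp (4 * real q * ln (exp 1 * r))"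
proof -
  obtain k where k: "q = Suc k" using \<open>q > 0\<close> by (auto dest: gr0_implies_Suc)
  have "(2 :: real) \<le> exp 4" using exp_ge_add_one_self[of "4::real"] by simp
  then have "(2 :: real) ^ k \<le> exp 4 ^ k" by (intro power_mono) auto
  then have "(2 :: real) ^ q \<le> 2 * exp (- 4) * exp 4 ^ q"
    by (simp add: k exp_minus field_simps)
  then have "2 ^ q * (r ^ q) ^ 4 \<le> 2 * exp (- 4) * exp 4 ^ q * (r ^ q) ^ 4"
    using \<open>r > 0\<close> by (intro mult_right_mono) auto
  also have "\<dots> = 2 * exp (- 4) * (exp 1 * r) ^ (4 * q)"
    using exp_of_nat_mult[of 4 "1::real"]
    by (simp add: power_mult_distrib mult.commute mult.assoc flip: power_mult)
  also have "(exp 1 * r) ^ (4 * q) = exp (4 * real q * ln (exp 1 * r))"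
    using powr_realpow[of "exp 1 * r" "4 * q"] \<open>r > 0\<close> by (simp add: powr_def)
  finally show ?thesis .
qed

lemma prod_partition_card_le:
  assumes "finite S" "S \<noteq> {}" and X: "partition_on S X"
  shows "(\<Prod>P\<in>X. 2 * real (card P) ^ 4)
    \<le> 2 * exp (- 4) * exp (4 * real (card X) * ln (exp 1 * real (card S) / real (card X)))"
proof -
  define q where "q = card X"
  define r where "r = real (card S) / real q"
  have "finite X" using assms(1) X by (rule finite_elements)
  have "X \<noteq> {}" using X assms(2) by (auto dest: partition_onD1)
  then have "q > 0" using \<open>finite X\<close> by (simp add: q_def card_gt_0_iff)
  then have "r > 0" using assms(1,2) by (simp add: r_def card_gt_0_iff)
  have "finite P" if "P \<in> X" for P
    using partition_on_block(1)[OF X that] assms(1) by (rule finite_subset)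
  then have "real (card S) = (\<Sum>P\<in>X. real (card P))"
    using product_partition[OF X] by simp
  then have "(\<Prod>P\<in>X. real (card P)) \<le> r ^ q"
    using prod_le_mean_power[OF \<open>finite X\<close> \<open>X \<noteq> {}\<close>, of "\<lambda>P. real (card P)"]
    by (simp add: r_def q_def)
  then have "(\<Prod>P\<in>X. real (card P)) ^ 4 \<le> (r ^ q) ^ 4"
    by (intro power_mono prod_nonneg) auto
  then have "(\<Prod>P\<in>X. 2 * real (card P) ^ 4) \<le> 2 ^ q * (r ^ q) ^ 4"
    by (simp add: prod.distrib prod_power_distrib q_def)
  also have "\<dots> \<le> 2 * exp (- 4) * exp (4 * real q * ln (exp 1 * r))"
    using \<open>r > 0\<close> \<open>q > 0\<close> by (rule two_power_mult_power_le_exp_ln)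
  finally show ?thesis by (simp add: r_def q_def)
qed

locale gaussian_convex_regression = gaussian_noise M \<xi> "{1..n}" \<sigma>
  for M :: "'a measure" and \<xi> :: "nat \<Rightarrow> 'a \<Rightarrow> real" and n :: nat and \<sigma> :: real +
  fixes x \<mu> :: "nat \<Rightarrow> real"
  assumes n_pos: "n \<ge> 1" and x_mono: "strict_mono_on {1..n} x"
begin

sublocale least_squares_projection n "convex_seqs n x"
  using n_pos by (rule least_squares_projection_convex_seqs)

definition loss :: "'a \<Rightarrow> real" where
  "loss \<omega> = scaled_norm_sq n (\<lambda>i. proj (\<lambda>i. \<mu> i + \<xi> i \<omega>) i - \<mu> i)"

definition oracle_bound :: "(nat \<Rightarrow> real) \<Rightarrow> real" where
  "oracle_bound u = scaled_norm_sq n (\<lambda>i. u i - \<mu> i)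
    + 16 * \<sigma>\<^sup>2 * real (num_pieces n x u) / real n * ln (exp 1 * real n / real (num_pieces n x u))"

definition penalty :: "nat \<Rightarrow> real" where
  "penalty q = 4 * real q * ln (exp 1 * real n / real q)"

abbreviation piece_bound :: "nat set \<Rightarrow> 'a \<Rightarrow> real" where
  "piece_bound T \<omega> \<equiv> convex_gain_bound (1 / (4 * \<sigma>\<^sup>2)) (\<lambda>i. \<xi> i \<omega>) T"

lemma oracle_bound_nonneg: "oracle_bound u \<ge> 0"
proof -
  have "real (num_pieces n x u) \<le> 1 * real n"
    using num_pieces_le[OF n_pos] by simp
  also have "\<dots> \<le> exp 1 * real n" by (intro mult_right_mono) auto
  finally have "1 \<le> exp 1 * real n / real (num_pieces n x u)"
    using num_pieces_pos[OF n_pos, of x u] by simp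
  then show ?thesis
    unfolding oracle_bound_def
    by (intro add_nonneg_nonneg scaled_norm_sq_nonneg mult_nonneg_nonneg ln_ge_zero) auto
qed

lemma measurable_loss [measurable]: "loss \<in> borel_measurable M"
proof -
  let ?F = "\<lambda>g. scaled_norm_sq n (\<lambda>i. proj (\<lambda>i. \<mu> i + g i) i - \<mu> i)"
  have shift: "(\<lambda>g i. \<mu> i + g i) \<in> borel_measurable (borel :: (nat \<Rightarrow> real) measure)"
    by (intro borel_measurable_continuous_onI continuous_on_coordinatewise_then_product
        continuous_intros continuous_on_coordinate)
  have "?F \<in> borel_measurable borel"
    unfolding scaled_norm_sq_def using measurable_compose[OF shift borel_measurable_proj]
    by (intro borel_measurable_times borel_measurable_sum borel_measurable_power
        borel_measurable_diff borel_measurable_const) auto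
  moreover have "depends_only_on ?F {1..n}"
    unfolding depends_only_on_def
  proof (intro allI impI)
    fix g h :: "nat \<Rightarrow> real" assume "\<forall>i\<in>{1..n}. g i = h i"
    then have "proj (\<lambda>i. \<mu> i + g i) = proj (\<lambda>i. \<mu> i + h i)"
      using depends_only_on_least_squares[of n "convex_seqs n x"]
      unfolding depends_only_on_def by simp
    then show "?F g = ?F h" by simp
  qed
  ultimately show ?thesis
    unfolding loss_def using measurable_noise by (rule measurable_depends_only_on)
qed

lemma nn_integral_exp_arms_le:
  assumes T: "T \<subseteq> {1..n}" and a: "a \<in> T"
  shows "(\<integral>\<^sup>+\<omega>. ennreal (exp (1 / (4 * \<sigma>\<^sup>2) * monotone_gain (\<lambda>i. \<xi> i \<omega>) (left_arm T a))) *
      ennreal (exp (1 / (4 * \<sigma>\<^sup>2) * monotone_gain (\<lambda>i. \<xi> i \<omega>) (right_arm T a))) \<partial>M)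
    \<le> ennreal (2 * real (card T) ^ 2)"
proof -
  let ?L = "left_arm T a" and ?R = "right_arm T a"
  let ?E = "\<lambda>xs g. ennreal (exp (1 / (4 * \<sigma>\<^sup>2) * monotone_gain g xs))"
  have "finite T" using T by (rule finite_subset) simp
  then have arms: "set ?L \<subseteq> {1..n}" "set ?R \<subseteq> {1..n}" "set ?L \<inter> set ?R = {}"
    using T by (auto simp: set_arms)
  have local: "depends_only_on (?E xs) (set xs)" for xs :: "nat list"
    by (rule depends_only_on_compose[OF depends_only_on_monotone_gain])
  have "(\<integral>\<^sup>+\<omega>. ?E ?L (\<lambda>i. \<xi> i \<omega>) * ?E ?R (\<lambda>i. \<xi> i \<omega>) \<partial>M)
      = (\<integral>\<^sup>+\<omega>. ?E ?L (\<lambda>i. \<xi> i \<omega>) \<partial>M) * (\<integral>\<^sup>+\<omega>. ?E ?R (\<lambda>i. \<xi> i \<omega>) \<partial>M)"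
    using indep arms
    by (rule nn_integral_mult_depends_only_on) (measurable, rule local, measurable, rule local)
  also have "\<dots> \<le> ennreal (real (length ?L) + 1) * ennreal (real (length ?R) + 1)"
    by (intro mult_mono nn_integral_exp_quarter_monotone_gain_le distinct_arms arms) auto
  also have "\<dots> = ennreal ((real (length ?L) + 1) * (real (length ?R) + 1))"
    by (simp add: ennreal_mult)
  also have "\<dots> \<le> ennreal (2 * real (card T) ^ 2)"
  proof (rule ennreal_leI)
    have "(real (length ?L) + 1) * (real (length ?R) + 1) \<le> real (card T) * (2 * real (card T))"
      using length_arms[OF \<open>finite T\<close> a] by (intro mult_mono) auto
    then show "(real (length ?L) + 1) * (real (length ?R) + 1) \<le> 2 * real (card T) ^ 2"
      by (simp add: power2_eq_square)
  qed
  finally show ?thesis .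
qed

lemma nn_integral_piece_bound_le:
  assumes T: "T \<subseteq> {1..n}" "T \<noteq> {}"
  shows "(\<integral>\<^sup>+\<omega>. piece_bound T \<omega> \<partial>M) \<le> ennreal (2 * real (card T) ^ 4)"
proof -
  let ?E = "\<lambda>xs \<omega>. ennreal (exp (1 / (4 * \<sigma>\<^sup>2) * monotone_gain (\<lambda>i. \<xi> i \<omega>) xs))"
  have "finite T" using T(1) by (rule finite_subset) simp
  then have [measurable]:
    "(\<lambda>\<omega>. monotone_gain (\<lambda>i. \<xi> i \<omega>) (left_arm T a)) \<in> borel_measurable M"
    "(\<lambda>\<omega>. monotone_gain (\<lambda>i. \<xi> i \<omega>) (right_arm T a)) \<in> borel_measurable M" for a
    using T by (auto intro!: measurable_monotone_gain_noise simp: set_arms)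
  have "(\<integral>\<^sup>+\<omega>. piece_bound T \<omega> \<partial>M)
      = (\<integral>\<^sup>+\<omega>. (\<Sum>a\<in>T. ?E (left_arm T a) \<omega> * ?E (right_arm T a) \<omega>) \<partial>M)"
    unfolding convex_gain_bound_def by (simp add: sum_ennreal ennreal_mult[symmetric])
  also have "\<dots> = (\<Sum>a\<in>T. \<integral>\<^sup>+\<omega>. ?E (left_arm T a) \<omega> * ?E (right_arm T a) \<omega> \<partial>M)"
    by (rule nn_integral_sum) measurable
  also have "\<dots> \<le> (\<Sum>a\<in>T. ennreal (2 * real (card T) ^ 2))"
    using T(1) by (intro sum_mono nn_integral_exp_arms_le)
  also have "\<dots> = ennreal (\<Sum>a\<in>T. 2 * real (card T) ^ 2)"
    by (rule sum_ennreal) simp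
  also have "(\<Sum>a\<in>T. 2 * real (card T) ^ 2) = 2 * real (card T) ^ 3"
    by (simp add: power3_eq_cube power2_eq_square)
  also have "\<dots> \<le> ennreal (2 * real (card T) ^ 4)"
    using T \<open>finite T\<close>
    by (intro ennreal_leI mult_left_mono power_increasing) (auto simp: Suc_le_eq card_gt_0_iff)
  finally show ?thesis .
qed

lemma measurable_piece_bound:
  assumes "T \<subseteq> {1..n}"
  shows "piece_bound T \<in> borel_measurable M"
proof -
  have "finite T" using assms by (rule finite_subset) simp
  then show ?thesis
    using assms measurable_noise
    by (intro measurable_depends_only_on[OF borel_measurable_convex_gain_bound
          depends_only_on_convex_gain_bound]) auto
qed

lemma nn_integral_prod_piece_bound_le:
  assumes X: "partition_on {1..n} X"
  shows "(\<integral>\<^sup>+\<omega>. ennreal (\<Prod>P\<in>X. piece_bound P \<omega>) \<partial>M)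
    \<le> ennreal (2 * exp (- 4) * exp (penalty (card X)))"
proof -
  let ?G = "\<lambda>P g. ennreal (convex_gain_bound (1 / (4 * \<sigma>\<^sup>2)) g P)"
  have "(\<integral>\<^sup>+\<omega>. ennreal (\<Prod>P\<in>X. piece_bound P \<omega>) \<partial>M) = (\<integral>\<^sup>+\<omega>. (\<Prod>P\<in>X. ?G P (\<lambda>i. \<xi> i \<omega>)) \<partial>M)"
    by (simp add: prod_ennreal)
  also have "\<dots> = (\<Prod>P\<in>X. \<integral>\<^sup>+\<omega>. piece_bound P \<omega> \<partial>M)"
  proof (rule nn_integral_prod_partition[OF indep _ _ X])
    fix P assume "P \<in> X"
    then have "finite P" using partition_on_block(1)[OF X] by (auto intro: finite_subset)
    then show "depends_only_on (?G P) P"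
      by (intro depends_only_on_compose[OF depends_only_on_convex_gain_bound])
  qed auto
  also have "\<dots> \<le> (\<Prod>P\<in>X. ennreal (2 * real (card P) ^ 4))"
    using partition_on_block[OF X] by (intro prod_mono_ennreal nn_integral_piece_bound_le)
  also have "\<dots> = ennreal (\<Prod>P\<in>X. 2 * real (card P) ^ 4)"
    by (rule prod_ennreal) simp
  also have "\<dots> \<le> ennreal (2 * exp (- 4) * exp (penalty (card X)))"
    using prod_partition_card_le[OF _ _ X] n_pos by (intro ennreal_leI) (simp add: penalty_def)
  finally show ?thesis .
qed

lemma exp_excess_loss_le_prod_piece_bound:
  assumes u: "u \<in> convex_seqs n x" and X: "partition_on {1..n} X" "card X = num_pieces n x u"
    and affine: "\<And>P. P \<in> X \<Longrightarrow> affine_along x P u"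
  shows "exp (real n / (4 * \<sigma>\<^sup>2) * (loss \<omega> - oracle_bound u))
    \<le> exp (- penalty (card X)) * (\<Prod>P\<in>X. piece_bound P \<omega>)"
proof -
  define v where "v = proj (\<lambda>i. \<mu> i + \<xi> i \<omega>)"
  let ?gain = "\<Sum>i=1..n. gain (\<lambda>i. \<xi> i \<omega>) (\<lambda>i. v i - u i) i"
  let ?penalty = "4 * \<sigma>\<^sup>2 * penalty (card X)"
  have "real n * (loss \<omega> - oracle_bound u)
      = (\<Sum>i=1..n. (v i - \<mu> i)\<^sup>2) - (\<Sum>i=1..n. (u i - \<mu> i)\<^sup>2) - ?penalty"
    using n_pos
    by (simp add: loss_def oracle_bound_def scaled_norm_sq_def penalty_def v_def X(2) field_simps)
  also have "\<dots> \<le> ?gain - ?penalty"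
    using sum_square_proj_diff_le[OF u, of \<mu> "\<lambda>i. \<xi> i \<omega>"] by (simp add: v_def)
  finally have "real n * (loss \<omega> - oracle_bound u) / (4 * \<sigma>\<^sup>2) \<le> (?gain - ?penalty) / (4 * \<sigma>\<^sup>2)"
    by (rule divide_right_mono) simp
  also have "\<dots> = 1 / (4 * \<sigma>\<^sup>2) * ?gain - penalty (card X)"
    using sigma_pos by (simp add: diff_divide_distrib)
  finally have "exp (real n / (4 * \<sigma>\<^sup>2) * (loss \<omega> - oracle_bound u))
      \<le> exp (- penalty (card X)) * exp (1 / (4 * \<sigma>\<^sup>2) * ?gain)"
    by (simp flip: exp_add)
  also have "\<dots> \<le> exp (- penalty (card X)) * (\<Prod>P\<in>X. piece_bound P \<omega>)"
    using X(1) affine x_mono convex_seqs_convex_along[OF proj_in x_mono] unfolding v_def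
    by (intro mult_left_mono exp_sum_gain_le_prod_convex_gain_bound) auto
  finally show ?thesis .
qed

lemma nn_integral_exp_excess_loss_le:
  assumes u: "u \<in> convex_seqs n x"
  shows "(\<integral>\<^sup>+\<omega>. exp (real n / (4 * \<sigma>\<^sup>2) * (loss \<omega> - oracle_bound u)) \<partial>M) \<le> ennreal (2 * exp (- 4))"
proof -
  obtain X where X: "partition_on {1..n} X" "card X = num_pieces n x u"
    and affine: "\<And>P. P \<in> X \<Longrightarrow> affine_along x P u"
    using num_pieces_partition[OF n_pos] by blast
  let ?G = "\<lambda>\<omega>. \<Prod>P\<in>X. piece_bound P \<omega>" and ?c = "exp (- penalty (card X))"
  have "(\<integral>\<^sup>+\<omega>. exp (real n / (4 * \<sigma>\<^sup>2) * (loss \<omega> - oracle_bound u)) \<partial>M)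
      \<le> (\<integral>\<^sup>+\<omega>. ennreal ?c * ennreal (?G \<omega>) \<partial>M)"
    using exp_excess_loss_le_prod_piece_bound[OF u X affine]
    by (intro nn_integral_mono) (simp add: prod_nonneg flip: ennreal_mult)
  also have "\<dots> = ennreal ?c * (\<integral>\<^sup>+\<omega>. ennreal (?G \<omega>) \<partial>M)"
    using partition_on_block(1)[OF X(1)]
    by (intro nn_integral_cmult measurable_compose[OF _ measurable_ennreal]
        borel_measurable_prod measurable_piece_bound)
  also have "\<dots> \<le> ennreal ?c * ennreal (2 * exp (- 4) * exp (penalty (card X)))"
    by (intro mult_left_mono nn_integral_prod_piece_bound_le X(1)) simp
  also have "\<dots> = ennreal (2 * exp (- 4))"
    by (simp add: mult_ac flip: ennreal_mult exp_add)
  finally show ?thesis .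
qed

lemma prob_loss_gt_oracle_bound_le:
  assumes u: "u \<in> convex_seqs n x"
  shows "prob {\<omega> \<in> space M. loss \<omega> > oracle_bound u + 4 * \<sigma>\<^sup>2 * t / real n}
    \<le> 2 * exp (- 4) * exp (- t)" (is "prob ?exceeds \<le> _")
proof -
  let ?Z = "\<lambda>\<omega>. ennreal (exp (real n / (4 * \<sigma>\<^sup>2) * (loss \<omega> - oracle_bound u)))"
  have "?exceeds \<subseteq> {\<omega> \<in> space M. 1 \<le> ennreal (exp (- t)) * ?Z \<omega>}"
  proof clarify
    fix \<omega> assume "oracle_bound u + 4 * \<sigma>\<^sup>2 * t / real n < loss \<omega>"
    then have "t < real n / (4 * \<sigma>\<^sup>2) * (loss \<omega> - oracle_bound u)"
      using sigma_pos n_pos by (simp add: field_simps)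
    then have "1 \<le> exp (- t) * exp (real n / (4 * \<sigma>\<^sup>2) * (loss \<omega> - oracle_bound u))"
      by (simp flip: exp_add)
    then show "1 \<le> ennreal (exp (- t)) * ?Z \<omega>"
      by (simp flip: ennreal_mult ennreal_1)
  qed
  then have "emeasure M ?exceeds \<le> emeasure M {\<omega> \<in> space M. 1 \<le> ennreal (exp (- t)) * ?Z \<omega>}"
    by (intro emeasure_mono) measurable
  also have "\<dots> \<le> ennreal (exp (- t)) * (\<integral>\<^sup>+\<omega>. ?Z \<omega> * indicator (space M) \<omega> \<partial>M)"
    by (rule nn_integral_Markov_inequality) measurable
  also have "\<dots> = ennreal (exp (- t)) * (\<integral>\<^sup>+\<omega>. ?Z \<omega> \<partial>M)"
    by (simp cong: nn_integral_cong)
  also have "\<dots> \<le> ennreal (exp (- t)) * ennreal (2 * exp (- 4))"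
    by (intro mult_left_mono nn_integral_exp_excess_loss_le u) simp
  also have "\<dots> = ennreal (2 * exp (- 4) * exp (- t))"
    by (simp add: mult.commute flip: ennreal_mult)
  finally show ?thesis by (simp add: emeasure_eq_measure)
qed

text \<open>The tail bound at \<open>t - 1\<close> absorbs the error of a near-minimiser, since \<open>2 / e\<^sup>3 < 1\<close>.\<close>

lemma oracle_inequality:
  "1 - exp (- t) < prob {\<omega> \<in> space M.
     loss \<omega> \<le> (INF u\<in>convex_seqs n x. oracle_bound u) + 4 * \<sigma>\<^sup>2 * t / real n}"
proof -
  let ?inf = "INF u\<in>convex_seqs n x. oracle_bound u"
  have "bdd_below (oracle_bound ` convex_seqs n x)"
    using oracle_bound_nonneg by (intro bdd_belowI2)
  moreover have "?inf < ?inf + 4 * \<sigma>\<^sup>2 / real n" using sigma_pos n_pos by simp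
  ultimately obtain u where u: "u \<in> convex_seqs n x" "oracle_bound u < ?inf + 4 * \<sigma>\<^sup>2 / real n"
    using cINF_less_iff[OF convex_seqs_nonempty] by blast
  define failure where
    "failure = {\<omega> \<in> space M. loss \<omega> > oracle_bound u + 4 * \<sigma>\<^sup>2 * (t - 1) / real n}"
  have [measurable]: "failure \<in> events" unfolding failure_def by measurable
  have "prob failure \<le> 2 * exp (- 4) * exp (- (t - 1))"
    unfolding failure_def by (rule prob_loss_gt_oracle_bound_le[OF u(1)])
  also have "\<dots> = 2 * exp (- 3) * exp (- t)"
    by (simp add: exp_add[symmetric] mult.assoc)
  also have "\<dots> < 1 * exp (- t)"
  proof (rule mult_strict_right_mono)
    have "(4 :: real) \<le> exp 3" using exp_ge_add_one_self[of "3::real"] by simp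
    then show "2 * exp (- 3) < (1 :: real)" by (simp add: exp_minus field_simps)
  qed simp
  finally have "1 - exp (- t) < prob (space M - failure)" by (simp add: prob_compl)
  also have "\<dots> \<le> prob {\<omega> \<in> space M. loss \<omega> \<le> ?inf + 4 * \<sigma>\<^sup>2 * t / real n}"
  proof (rule finite_measure_mono)
    have "oracle_bound u + 4 * \<sigma>\<^sup>2 * (t - 1) / real n \<le> ?inf + 4 * \<sigma>\<^sup>2 * t / real n"
      using u(2) by (simp add: right_diff_distrib diff_divide_distrib)
    then show "space M - failure \<subseteq> {\<omega> \<in> space M. loss \<omega> \<le> ?inf + 4 * \<sigma>\<^sup>2 * t / real n}"
      by (auto simp: failure_def not_less)
  qed measurable
  finally show ?thesis .
qed

end

theorem theorem4p3:
  fixes M :: "'a measure" and n :: nat and \<mu> x :: "nat \<Rightarrow> real" and \<sigma> t :: real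
    and \<xi> :: "nat \<Rightarrow> 'a \<Rightarrow> real" and y \<mu>hat :: "'a \<Rightarrow> nat \<Rightarrow> real"
  assumes "prob_space M"
    and "n \<ge> 3"
    and "\<sigma> > 0"
    and "strict_mono_on {1..n} x"
    and "prob_space.indep_vars M (\<lambda>_. borel) \<xi> {1..n}"
    and "\<And>i. i \<in> {1..n} \<Longrightarrow> distributed M lborel (\<xi> i) (normal_density 0 \<sigma>)"
    and "\<And>\<omega> i. y \<omega> i = \<mu> i + \<xi> i \<omega>"
    and "\<And>\<omega>. \<mu>hat \<omega> = least_squares n (convex_seqs n x) (y \<omega>)"
    and "t > 0"
  shows "measure M {\<omega> \<in> space M.
      scaled_norm_sq n (\<lambda>i. \<mu>hat \<omega> i - \<mu> i) \<le>
        (INF u\<in>convex_seqs n x.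
           scaled_norm_sq n (\<lambda>i. u i - \<mu> i)
           + 16 * \<sigma>\<^sup>2 * real (num_pieces n x u) / real n
             * ln (exp 1 * real n / real (num_pieces n x u)))
        + 4 * \<sigma>\<^sup>2 * t / real n} > 1 - exp (- t)"
proof -
  interpret prob_space M by fact
  interpret gaussian_convex_regression M \<xi> n \<sigma> x \<mu>
    using assms by unfold_locales auto
  have "y \<omega> = (\<lambda>i. \<mu> i + \<xi> i \<omega>)" for \<omega>
    using assms(7) by blast
  then have "loss \<omega> = scaled_norm_sq n (\<lambda>i. \<mu>hat \<omega> i - \<mu> i)" for \<omega>
    by (simp add: loss_def assms(8))
  then show ?thesis
    using oracle_inequality[of t] by (simp add: oracle_bound_def)
qed

end
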